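(* Let $n\ge 1$ and let $\mathcal{S}$ be a semigroup which is faithfully represented by $\mathcal{M}_n(\mathbb{T})$, i.e., such that there is an injective semigroup homomorphism $\mathcal{S}\to\mathcal{M}_n(\mathbb{T})$. Then $\mathcal{S}$ satisfies a nontrivial semigroup identity.
   Context: $\mathbb{T}=\mathbb{R}\cup\{-\infty\}$ is the max-plus (tropical) semiring: addition is $\max$ and multiplication is the usual $+$. $\mathcal{M}_n(\mathbb{T})$ is the monoid of all $n\times n$ matrices over $\mathbb{T}$ with the induced matrix multiplication, $(AB)_{i,j}=\max_k(A_{i,k}+B_{k,j})$. The alphabet is $\{a,b\}$, and $\{a,b\}^+$ is the free semigroup of nonempty words. A (nontrivial) semigroup identity is a pair $\langle u,v\rangle$ of two different words $u,v\in\{a,b\}^+$. A semigroup $\mathcal{S}$ satisfies $\langle u,v\rangle$ if $\phi(u)=\phi(v)$ for every semigroup homomorphism $\phi:\{a,b\}^+\to\mathcal{S}$. *)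

theory Defs
  imports "HOL-Library.FuncSet" "Jordan_Normal_Form.Matrix" "Jordan_Normal_Form.Show_Arctic"
begin

(* arctic_delta adjoins a bottom element MinInfty_delta, read as minus infinity, to a linearly
   ordered field; its semiring operations are
     x + y = max(x, y),  x * y = the ordinary sum,  0 = MinInfty_delta,  1 = Num_arc_delta 0.
   Hence matrix multiplication over it is the max-plus product of matrices.
   Pitfall: the library's strict order also has MinInfty_delta < MinInfty_delta; only the
   semiring operations are used here. *)
type_synonym tropical = "real arctic_delta"

abbreviation tropical_mats :: "nat \<Rightarrow> tropical mat set" where
  "tropical_mats n \<equiv> carrier_mat n n"

(* Semigroups are a carrier set with a binary operation, so that subsets of types such as
   nonempty lists and n x n matrices qualify. The empty semigroup is not excluded. *)
definition semigroup_on :: "'s set \<Rightarrow> ('s \<Rightarrow> 's \<Rightarrow> 's) \<Rightarrow> bool" where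
  "semigroup_on S f \<longleftrightarrow>
     (\<forall>x\<in>S. \<forall>y\<in>S. f x y \<in> S) \<and>
     (\<forall>x\<in>S. \<forall>y\<in>S. \<forall>z\<in>S. f (f x y) z = f x (f y z))"

definition semigroup_homs ::
  "'s set \<Rightarrow> ('s \<Rightarrow> 's \<Rightarrow> 's) \<Rightarrow> 't set \<Rightarrow> ('t \<Rightarrow> 't \<Rightarrow> 't) \<Rightarrow> ('s \<Rightarrow> 't) set" where
  "semigroup_homs S f T g =
     {\<phi> \<in> S \<rightarrow> T. \<forall>x\<in>S. \<forall>y\<in>S. \<phi> (f x y) = g (\<phi> x) (\<phi> y)}"

datatype letter = Letter_a | Letter_b

definition words :: "letter list set" where
  "words = {w. w \<noteq> []}"

definition satisfies_identity ::
  "'s set \<Rightarrow> ('s \<Rightarrow> 's \<Rightarrow> 's) \<Rightarrow> letter list \<Rightarrow> letter list \<Rightarrow> bool" where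
  "satisfies_identity S f u v \<longleftrightarrow> (\<forall>\<phi>\<in>semigroup_homs words (@) S f. \<phi> u = \<phi> v)"

end

theory Submission
  imports Defs "HOL-Combinatorics.Cycles"
begin

text \<open>An entry of a word in max-plus matrices is the maximal weight of a walk labelled by that word.
  By induction on \<open>n\<close> there is an identity \<open>p = q\<close> for real \<open>(n - 1) \<times> (n - 1)\<close> matrices. If some word \<open>c\<close>
  evaluates at \<open>A, B\<close> to a product \<open>P Q\<close> through dimension \<open>n - 1\<close>, then \<open>c p(r c, s c) = c q(r c, s c)\<close>
  for all \<open>r, s\<close>, because both sides are \<open>P\<close> times a word in \<open>(n - 1) \<times> (n - 1)\<close> matrices times \<open>Q\<close>.
  It therefore suffices to find \<open>r \<noteq> s\<close> of equal length that agree whenever no short word factors in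
  this way, and to take for \<open>c\<close> a word containing all short words.

  If a long power \<open>Z\<^sup>T\<close> does not factor, every node \<open>k\<close> is unavoidable at the middle time for some
  pair of end points. Shifting an optimal walk in time, by deleting cycles on one side and repeating
  cycles on the other, then shows that the loop at \<open>k\<close> in \<open>X = Z\<^bsup>n!\<^esup>\<close> is strictly heavier than every other
  closed walk through \<open>k\<close>. Hence the identity is the unique heaviest permutation of \<open>X\<close>.
  For a word \<open>w\<close> in \<open>x = a\<^bsup>n!\<^esup>\<close> and \<open>y = b\<^bsup>n!\<^esup>\<close>, the heaviest closed walks of \<open>w\<^bsup>n!\<^esup>\<close> at different nodes never
  meet, since two of them could swap tails; so they move by permutations at each step, and comparing
  the total weight with that of the constant walks shows that they are constant. Thus \<open>x\<close> and \<open>y\<close> behave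
  like triangular matrices: an optimal walk never returns to a node it has left. As \<open>x y\<close> and \<open>y x\<close> have
  the same diagonal, \<open>Z (x y) Z = Z (y x) Z\<close> for any \<open>Z\<close> with enough copies of a universal word: the
  few moves of an optimal walk can be pushed into copies of the universal word away from the middle.\<close>

section \<open>Max-plus products and walks\<close>

type_synonym rmat = "nat \<Rightarrow> nat \<Rightarrow> real"

text \<open>\<open>r\<close> is the inner dimension. Matrices are total functions without outer
  dimensions, so products through the smaller dimension \<open>n - 1\<close> live in the same type.
  \<open>Max\<close> of the empty set is unspecified, hence the assumptions \<open>r > 0\<close>
  below.\<close>

definition maxplus_mult :: "nat \<Rightarrow> rmat \<Rightarrow> rmat \<Rightarrow> rmat" where
  "maxplus_mult r A B = (\<lambda>i j. Max ((\<lambda>k. A i k + B k j) ` {..<r}))"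

lemma maxplus_mult_ge: "k < r \<Longrightarrow> A i k + B k j \<le> maxplus_mult r A B i j"
  unfolding maxplus_mult_def by (rule Max_ge) auto

lemma maxplus_mult_attained:
  assumes "r > 0"
  obtains k where "k < r" "maxplus_mult r A B i j = A i k + B k j"
proof -
  have "maxplus_mult r A B i j \<in> (\<lambda>k. A i k + B k j) ` {..<r}"
    unfolding maxplus_mult_def by (rule Max_in) (use assms in auto)
  then show ?thesis using that by auto
qed

lemma maxplus_mult_le_iff:
  "r > 0 \<Longrightarrow> maxplus_mult r A B i j \<le> c \<longleftrightarrow> (\<forall>k<r. A i k + B k j \<le> c)"
  unfolding maxplus_mult_def by (subst Max_le_iff) auto

lemma maxplus_mult_cong:
  assumes "\<And>k. k < r \<Longrightarrow> A i k = A' i k" "\<And>k. k < r \<Longrightarrow> B k j = B' k j"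
  shows "maxplus_mult r A B i j = maxplus_mult r A' B' i j"
  unfolding maxplus_mult_def using assms by (intro arg_cong[where f = Max] image_cong) auto

lemma maxplus_mult_assoc:
  assumes "r > 0" "s > 0"
  shows "maxplus_mult r (maxplus_mult s A B) C = maxplus_mult s A (maxplus_mult r B C)"
proof (intro ext antisym)
  fix i j
  show "maxplus_mult r (maxplus_mult s A B) C i j \<le> maxplus_mult s A (maxplus_mult r B C) i j"
    unfolding maxplus_mult_le_iff[OF assms(1)]
  proof (intro allI impI)
    fix k assume k: "k < r"
    obtain l where l: "l < s" "maxplus_mult s A B i k = A i l + B l k"
      using maxplus_mult_attained[OF assms(2)] by blast
    have "B l k + C k j \<le> maxplus_mult r B C l j" by (rule maxplus_mult_ge[OF k])
    moreover have "A i l + maxplus_mult r B C l j \<le> maxplus_mult s A (maxplus_mult r B C) i j"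
      by (rule maxplus_mult_ge[OF l(1)])
    ultimately show "maxplus_mult s A B i k + C k j \<le> maxplus_mult s A (maxplus_mult r B C) i j"
      using l(2) by simp
  qed
  show "maxplus_mult s A (maxplus_mult r B C) i j \<le> maxplus_mult r (maxplus_mult s A B) C i j"
    unfolding maxplus_mult_le_iff[OF assms(2)]
  proof (intro allI impI)
    fix l assume l: "l < s"
    obtain k where k: "k < r" "maxplus_mult r B C l j = B l k + C k j"
      using maxplus_mult_attained[OF assms(1)] by blast
    have "A i l + B l k \<le> maxplus_mult s A B i k" by (rule maxplus_mult_ge[OF l])
    moreover have "maxplus_mult s A B i k + C k j \<le> maxplus_mult r (maxplus_mult s A B) C i j"
      by (rule maxplus_mult_ge[OF k(1)])
    ultimately show "A i l + maxplus_mult r B C l j \<le> maxplus_mult r (maxplus_mult s A B) C i j"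
      using k(2) by simp
  qed
qed

text \<open>The value of the empty word is junk: real matrices have no max-plus unit.\<close>

fun word_val :: "nat \<Rightarrow> ('l \<Rightarrow> rmat) \<Rightarrow> 'l list \<Rightarrow> rmat" where
  "word_val n \<phi> [] = (\<lambda>i j. 0)"
| "word_val n \<phi> [l] = \<phi> l"
| "word_val n \<phi> (l # w) = maxplus_mult n (\<phi> l) (word_val n \<phi> w)"

lemma word_val_Cons: "w \<noteq> [] \<Longrightarrow> word_val n \<phi> (l # w) = maxplus_mult n (\<phi> l) (word_val n \<phi> w)"
  by (cases w) auto

lemma word_val_append:
  assumes "n > 0" "u \<noteq> []" "v \<noteq> []"
  shows "word_val n \<phi> (u @ v) = maxplus_mult n (word_val n \<phi> u) (word_val n \<phi> v)"
  using assms(2)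
proof (induction u)
  case (Cons l u)
  then show ?case
    by (cases "u = []") (use assms in \<open>simp_all add: word_val_Cons maxplus_mult_assoc\<close>)
qed simp

section \<open>Substituting words for letters\<close>

definition subst_word :: "('k \<Rightarrow> 'l list) \<Rightarrow> 'k list \<Rightarrow> 'l list" where
  "subst_word \<sigma> w = concat (map \<sigma> w)"

lemma subst_word_simps [simp]:
  "subst_word \<sigma> [] = []" "subst_word \<sigma> (l # w) = \<sigma> l @ subst_word \<sigma> w" "subst_word \<sigma> (u @ v) = subst_word \<sigma> u @ subst_word \<sigma> v"
  by (simp_all add: subst_word_def)

lemma subst_word_eq_Nil_iff: "(\<And>l. \<sigma> l \<noteq> []) \<Longrightarrow> subst_word \<sigma> w = [] \<longleftrightarrow> w = []"
  by (cases w) auto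

lemma length_subst_word: "(\<And>l. length (\<sigma> l) = m) \<Longrightarrow> length (subst_word \<sigma> w) = m * length w"
  by (induction w) auto

lemma subst_word_inj:
  assumes "\<And>l. length (\<sigma> l) = m" "inj \<sigma>" "length u = length v" "subst_word \<sigma> u = subst_word \<sigma> v"
  shows "u = v"
  using assms(3,4)
proof (induction u v rule: list_induct2)
  case (Cons x xs y ys)
  then show ?case using assms(1,2) by (auto dest: injD)
qed simp

lemma word_val_subst:
  assumes "n > 0" "\<And>l. \<sigma> l \<noteq> []" "w \<noteq> []"
  shows "word_val n \<phi> (subst_word \<sigma> w) = word_val n (\<lambda>l. word_val n \<phi> (\<sigma> l)) w"
  using assms(3)
proof (induction w)
  case (Cons l w)
  show ?case
  proof (cases "w = []")
    case False
    then have "subst_word \<sigma> w \<noteq> []" using subst_word_eq_Nil_iff[of \<sigma>] assms(2) by metis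
    then show ?thesis using Cons.IH False assms by (simp add: word_val_append word_val_Cons)
  qed simp
qed simp

lemma word_val_cong:
  assumes "\<And>l k k'. k < n \<Longrightarrow> k' < n \<Longrightarrow> \<phi> l k k' = \<psi> l k k'" "i < n" "j < n"
  shows "word_val n \<phi> w i j = word_val n \<psi> w i j"
  using assms(2)
proof (induction w arbitrary: i)
  case (Cons l w)
  show ?case
    by (cases "w = []") (use Cons assms in \<open>auto simp: word_val_Cons intro!: maxplus_mult_cong\<close>)
qed simp

lemma word_val_const:
  "word_val n (\<lambda>_. M) u = word_val n (\<lambda>_. M) (replicate (length u) ())"
  by (induction u rule: induct_list012) auto

section \<open>Weights of walks and their relation to word values\<close>

definition walk_weight :: "('l \<Rightarrow> rmat) \<Rightarrow> 'l list \<Rightarrow> (nat \<Rightarrow> nat) \<Rightarrow> real" where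
  "walk_weight \<phi> w p = (\<Sum>t<length w. \<phi> (w ! t) (p t) (p (Suc t)))"

lemma walk_weight_Nil [simp]: "walk_weight \<phi> [] p = 0"
  by (simp add: walk_weight_def)

lemma walk_weight_Cons [simp]:
  "walk_weight \<phi> (l # w) p = \<phi> l (p 0) (p 1) + walk_weight \<phi> w (\<lambda>t. p (Suc t))"
  by (simp add: walk_weight_def sum.lessThan_Suc_shift del: sum.lessThan_Suc)

lemma walk_weight_append:
  "walk_weight \<phi> (u @ v) p = walk_weight \<phi> u p + walk_weight \<phi> v (\<lambda>t. p (length u + t))"
  by (induction u arbitrary: p) auto

lemma walk_weight_cong:
  "(\<And>t. t \<le> length w \<Longrightarrow> p t = q t) \<Longrightarrow> walk_weight \<phi> w p = walk_weight \<phi> w q"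
  unfolding walk_weight_def by (intro sum.cong) auto

definition diag_weight :: "('l \<Rightarrow> rmat) \<Rightarrow> 'l list \<Rightarrow> nat \<Rightarrow> real" where
  "diag_weight \<phi> w k = (\<Sum>l\<leftarrow>w. \<phi> l k k)"

lemma diag_weight_append [simp]:
  "diag_weight \<phi> (u @ v) k = diag_weight \<phi> u k + diag_weight \<phi> v k"
  by (simp add: diag_weight_def)

lemma diag_weight_simps [simp]:
  "diag_weight \<phi> [] k = 0" "diag_weight \<phi> (l # w) k = \<phi> l k k + diag_weight \<phi> w k"
  by (simp_all add: diag_weight_def)

lemma walk_weight_const: "walk_weight \<phi> w (\<lambda>_. k) = diag_weight \<phi> w k"
  by (induction w) auto

lemma diag_weight_eq_sum: "diag_weight \<phi> w k = (\<Sum>t<length w. \<phi> (w ! t) k k)"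
  by (simp add: walk_weight_const[symmetric] walk_weight_def)

text \<open>Walks take values below \<open>n\<close> at all times \<open>0, \<dots>, length w\<close>; the values at later
  times are junk.\<close>

definition reach :: "nat \<Rightarrow> ('l \<Rightarrow> rmat) \<Rightarrow> 'l list \<Rightarrow> nat \<Rightarrow> nat \<Rightarrow> real \<Rightarrow> bool" where
  "reach n \<phi> w i j c \<longleftrightarrow>
     (\<exists>p. (\<forall>t\<le>length w. p t < n) \<and> p 0 = i \<and> p (length w) = j \<and> c \<le> walk_weight \<phi> w p)"

lemma reachI:
  "(\<And>t. t \<le> length w \<Longrightarrow> p t < n) \<Longrightarrow> p 0 = i \<Longrightarrow> p (length w) = j \<Longrightarrow> c \<le> walk_weight \<phi> w p
    \<Longrightarrow> reach n \<phi> w i j c"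
  unfolding reach_def by blast

lemma reach_mono: "reach n \<phi> w i j c \<Longrightarrow> c' \<le> c \<Longrightarrow> reach n \<phi> w i j c'"
  unfolding reach_def using order_trans by blast

lemma reach_lt: "reach n \<phi> w i j c \<Longrightarrow> i < n \<and> j < n"
  unfolding reach_def by blast

lemma reach_Nil [simp]: "reach n \<phi> [] i j c \<longleftrightarrow> i < n \<and> i = j \<and> c \<le> 0"
  unfolding reach_def by auto

lemma reach_glue:
  assumes "reach n \<phi> u i k c" "reach n \<phi> v k j d"
  obtains p where "\<And>t. t \<le> length (u @ v) \<Longrightarrow> p t < n" "p 0 = i" "p (length u) = k"
    "p (length (u @ v)) = j" "c + d \<le> walk_weight \<phi> (u @ v) p"
proof -
  obtain p where p: "\<And>t. t \<le> length u \<Longrightarrow> p t < n" "p 0 = i" "p (length u) = k"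
    "c \<le> walk_weight \<phi> u p" using assms(1) unfolding reach_def by blast
  obtain q where q: "\<And>t. t \<le> length v \<Longrightarrow> q t < n" "q 0 = k" "q (length v) = j"
    "d \<le> walk_weight \<phi> v q" using assms(2) unfolding reach_def by blast
  define r where "r = (\<lambda>t. if t \<le> length u then p t else q (t - length u))"
  have r1: "walk_weight \<phi> u r = walk_weight \<phi> u p"
    by (rule walk_weight_cong) (simp add: r_def)
  have r2: "walk_weight \<phi> v (\<lambda>t. r (length u + t)) = walk_weight \<phi> v q"
    by (rule walk_weight_cong) (use p q in \<open>auto simp: r_def\<close>)
  show ?thesis
  proof (rule that[of r])
    show "r t < n" if "t \<le> length (u @ v)" for t
      using p(1)[of t] q(1)[of "t - length u"] that by (auto simp: r_def)
    show "r (length (u @ v)) = j" using p(3) q(2,3) by (auto simp: r_def)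
    show "c + d \<le> walk_weight \<phi> (u @ v) r"
      using p(4) q(4) by (simp add: walk_weight_append r1 r2)
  qed (simp_all add: r_def p(2,3))
qed

lemma reach_append:
  assumes "reach n \<phi> u i k c" "reach n \<phi> v k j d"
  shows "reach n \<phi> (u @ v) i j (c + d)"
  by (rule reach_glue[OF assms]) (rule reachI)

lemma reach_appendE:
  assumes "reach n \<phi> (u @ v) i j c"
  obtains k c1 c2 where "reach n \<phi> u i k c1" "reach n \<phi> v k j c2" "c \<le> c1 + c2"
proof -
  obtain p where p: "\<And>t. t \<le> length (u @ v) \<Longrightarrow> p t < n" "p 0 = i" "p (length (u @ v)) = j"
    "c \<le> walk_weight \<phi> (u @ v) p" using assms(1) unfolding reach_def by blast
  have "reach n \<phi> u i (p (length u)) (walk_weight \<phi> u p)"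
    by (rule reachI[of _ p]) (use p in auto)
  moreover have "reach n \<phi> v (p (length u)) j (walk_weight \<phi> v (\<lambda>t. p (length u + t)))"
    by (rule reachI[of _ "\<lambda>t. p (length u + t)"]) (use p in auto)
  ultimately show ?thesis using that p(4) by (simp add: walk_weight_append)
qed

lemma reach_single: "i < n \<Longrightarrow> j < n \<Longrightarrow> reach n \<phi> [l] i j (\<phi> l i j)"
  by (rule reachI[of _ "\<lambda>t. if t = 0 then i else j"]) auto

lemma reach_diag: "k < n \<Longrightarrow> reach n \<phi> w k k (diag_weight \<phi> w k)"
  by (rule reachI[of _ "\<lambda>_. k"]) (auto simp: walk_weight_const)

lemma reach_word_val:
  assumes "w \<noteq> []" "i < n" "j < n"
  shows "reach n \<phi> w i j (word_val n \<phi> w i j)"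
  using assms
proof (induction w arbitrary: i)
  case (Cons l w)
  show ?case
  proof (cases "w = []")
    case False
    have "n > 0" using Cons by simp
    then obtain k where k: "k < n"
      "maxplus_mult n (\<phi> l) (word_val n \<phi> w) i j = \<phi> l i k + word_val n \<phi> w k j"
      using maxplus_mult_attained by blast
    have "reach n \<phi> ([l] @ w) i j (\<phi> l i k + word_val n \<phi> w k j)"
      by (rule reach_append[OF reach_single Cons.IH]) (use k Cons.prems False in auto)
    then show ?thesis using k False by (simp add: word_val_Cons)
  qed (use Cons reach_single in auto)
qed simp

lemma walk_weight_le_word_val:
  assumes "w \<noteq> []" "\<And>t. t \<le> length w \<Longrightarrow> p t < n"
  shows "walk_weight \<phi> w p \<le> word_val n \<phi> w (p 0) (p (length w))"
  using assms
proof (induction w arbitrary: p)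
  case (Cons l w)
  show ?case
  proof (cases "w = []")
    case False
    have "walk_weight \<phi> w (\<lambda>t. p (Suc t)) \<le> word_val n \<phi> w (p (Suc 0)) (p (Suc (length w)))"
      using Cons.IH[OF False, of "\<lambda>t. p (Suc t)"] Cons.prems by simp
    moreover have "\<phi> l (p 0) (p (Suc 0)) + word_val n \<phi> w (p (Suc 0)) (p (Suc (length w)))
        \<le> maxplus_mult n (\<phi> l) (word_val n \<phi> w) (p 0) (p (Suc (length w)))"
      by (rule maxplus_mult_ge) (use Cons.prems in simp)
    ultimately show ?thesis using False by (simp add: word_val_Cons)
  qed simp
qed simp

lemma reach_le_word_val:
  assumes "reach n \<phi> w i j c" "w \<noteq> []"
  shows "c \<le> word_val n \<phi> w i j"
proof -
  obtain p where p: "\<And>t. t \<le> length w \<Longrightarrow> p t < n" "p 0 = i" "p (length w) = j"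
    "c \<le> walk_weight \<phi> w p" using assms(1) unfolding reach_def by blast
  have "walk_weight \<phi> w p \<le> word_val n \<phi> w (p 0) (p (length w))"
    by (rule walk_weight_le_word_val[OF assms(2) p(1)])
  then show ?thesis using p by simp
qed

lemma diag_weight_le_word_val: "k < n \<Longrightarrow> w \<noteq> [] \<Longrightarrow> diag_weight \<phi> w k \<le> word_val n \<phi> w k k"
  by (rule reach_le_word_val[OF reach_diag])

lemma optimal_walk:
  assumes "w \<noteq> []" "i < n" "j < n"
  obtains p where "\<And>t. t \<le> length w \<Longrightarrow> p t < n" "p 0 = i" "p (length w) = j"
    "walk_weight \<phi> w p = word_val n \<phi> w i j"
proof -
  obtain p where p: "\<And>t. t \<le> length w \<Longrightarrow> p t < n" "p 0 = i" "p (length w) = j"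
    "word_val n \<phi> w i j \<le> walk_weight \<phi> w p"
    using reach_word_val[OF assms] unfolding reach_def by blast
  have "walk_weight \<phi> w p \<le> word_val n \<phi> w (p 0) (p (length w))"
    by (rule walk_weight_le_word_val[OF assms(1) p(1)])
  then show ?thesis using that[OF p(1-3)] p by simp
qed

section \<open>Powers that do not factor through a smaller dimension\<close>

text \<open>For \<open>n \<ge> 2\<close> this says that the max-plus factor rank (Barvinok rank) is
  at most \<open>n - 1\<close>.\<close>

definition low_rank :: "nat \<Rightarrow> rmat \<Rightarrow> bool" where
  "low_rank n M \<longleftrightarrow> (\<exists>P Q. \<forall>i<n. \<forall>j<n. M i j = maxplus_mult (n - 1) P Q i j)"

text \<open>If every entry of the product were attained at some node other than \<open>k\<close>,
  column \<open>k\<close> of \<open>A\<close> and row \<open>k\<close> of \<open>B\<close> could be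
  deleted, leaving a factorization through dimension \<open>n - 1\<close>.\<close>

lemma strict_node_if_not_low_rank:
  assumes "n \<ge> 2" "\<not> low_rank n (maxplus_mult n A B)" "k < n"
  obtains i j where "i < n" "j < n"
    "\<And>l. l < n \<Longrightarrow> l \<noteq> k \<Longrightarrow> A i l + B l j < maxplus_mult n A B i j"
proof (rule ccontr)
  note witness = that
  assume no: "\<not> thesis"
  have ex: "\<exists>l<n. l \<noteq> k \<and> maxplus_mult n A B i j \<le> A i l + B l j" if "i < n" "j < n" for i j
    using no witness[OF that] by (meson linorder_not_less)
  define f where "f = (\<lambda>m. if m < k then m else Suc m)"
  have "maxplus_mult n A B i j = maxplus_mult (n - 1) (\<lambda>i m. A i (f m)) (\<lambda>m j. B (f m) j) i j"
    if ij: "i < n" "j < n" for i j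
  proof (rule antisym)
    obtain l where l: "l < n" "l \<noteq> k" "maxplus_mult n A B i j \<le> A i l + B l j"
      using ex[OF ij] by blast
    define m where "m = (if l < k then l else l - 1)"
    have m: "m < n - 1" "f m = l" using l assms(1,3) by (auto simp: m_def f_def)
    show "maxplus_mult n A B i j \<le> maxplus_mult (n - 1) (\<lambda>i m. A i (f m)) (\<lambda>m j. B (f m) j) i j"
      using l(3) maxplus_mult_ge[OF m(1), of "\<lambda>i m. A i (f m)" i "\<lambda>m j. B (f m) j" j] m(2) by simp
    show "maxplus_mult (n - 1) (\<lambda>i m. A i (f m)) (\<lambda>m j. B (f m) j) i j \<le> maxplus_mult n A B i j"
      by (subst maxplus_mult_le_iff)
        (use assms(1) in \<open>auto intro!: maxplus_mult_ge simp: f_def\<close>)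
  qed
  then have "low_rank n (maxplus_mult n A B)" unfolding low_rank_def by blast
  then show False using assms(2) by blast
qed

lemma low_rank_mult_left:
  assumes "n \<ge> 2" "low_rank n B" shows "low_rank n (maxplus_mult n A B)"
proof -
  obtain P Q where PQ: "\<And>i j. i < n \<Longrightarrow> j < n \<Longrightarrow> B i j = maxplus_mult (n - 1) P Q i j"
    using assms(2) unfolding low_rank_def by blast
  have "maxplus_mult n A B i j = maxplus_mult (n - 1) (maxplus_mult n A P) Q i j"
    if "i < n" "j < n" for i j
  proof -
    have "maxplus_mult n A B i j = maxplus_mult n A (maxplus_mult (n - 1) P Q) i j"
      by (rule maxplus_mult_cong) (use PQ that in auto)
    then show ?thesis using assms(1) by (simp add: maxplus_mult_assoc)
  qed
  then show ?thesis unfolding low_rank_def by blast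
qed

lemma low_rank_mult_right:
  assumes "n \<ge> 2" "low_rank n A" shows "low_rank n (maxplus_mult n A B)"
proof -
  obtain P Q where PQ: "\<And>i j. i < n \<Longrightarrow> j < n \<Longrightarrow> A i j = maxplus_mult (n - 1) P Q i j"
    using assms(2) unfolding low_rank_def by blast
  have "maxplus_mult n A B i j = maxplus_mult (n - 1) P (maxplus_mult n Q B) i j"
    if "i < n" "j < n" for i j
  proof -
    have "maxplus_mult n A B i j = maxplus_mult n (maxplus_mult (n - 1) P Q) B i j"
      by (rule maxplus_mult_cong) (use PQ that in auto)
    then show ?thesis using assms(1) by (simp add: maxplus_mult_assoc)
  qed
  then show ?thesis unfolding low_rank_def by blast
qed

text \<open>Powers of one matrix are words over the one-letter type \<open>unit\<close>, so the walk
  lemmas apply to them. Exponent 0 is the empty walk, which stands in for the missing unit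
  matrix.\<close>

abbreviation reach_pow :: "nat \<Rightarrow> rmat \<Rightarrow> nat \<Rightarrow> nat \<Rightarrow> nat \<Rightarrow> real \<Rightarrow> bool" where
  "reach_pow n Z t \<equiv> reach n (\<lambda>_. Z) (replicate t ())"

lemma reach_pow_add:
  "reach_pow n Z s i k c \<Longrightarrow> reach_pow n Z t k j d \<Longrightarrow> reach_pow n Z (s + t) i j (c + d)"
  by (simp add: replicate_add reach_append)

lemma reach_pow_sum:
  assumes "x 0 < n" "\<And>a. a < N \<Longrightarrow> reach_pow n Z (len a) (x a) (x (Suc a)) (c a)"
  shows "reach_pow n Z (\<Sum>a<N. len a) (x 0) (x N) (\<Sum>a<N. c a)"
  using assms(2)
proof (induction N)
  case (Suc N)
  then show ?case using reach_pow_add by simp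
qed (use assms(1) in simp)

lemma reach_pow_segment:
  assumes "\<And>t. t \<le> T \<Longrightarrow> p t < n" "s \<le> t" "t \<le> T"
  shows "reach_pow n Z (t - s) (p s) (p t) (\<Sum>\<tau>=s..<t. Z (p \<tau>) (p (Suc \<tau>)))"
proof (rule reachI[of _ "\<lambda>\<tau>. p (s + \<tau>)"])
  have "(\<Sum>\<tau>=s..<t. Z (p \<tau>) (p (Suc \<tau>))) = (\<Sum>\<tau><t - s. Z (p (s + \<tau>)) (p (Suc (s + \<tau>))))"
    by (rule sum.reindex_bij_witness[of _ "\<lambda>\<tau>. s + \<tau>" "\<lambda>\<tau>. \<tau> - s"]) auto
  then show "(\<Sum>\<tau>=s..<t. Z (p \<tau>) (p (Suc \<tau>)))
      \<le> walk_weight (\<lambda>_. Z) (replicate (t - s) ()) (\<lambda>\<tau>. p (s + \<tau>))"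
    by (simp add: walk_weight_def)
qed (use assms in auto)

lemma reach_powE:
  assumes "reach_pow n Z T i j c"
  obtains p where "\<And>t. t \<le> T \<Longrightarrow> p t < n" "p 0 = i" "p T = j"
    "c \<le> (\<Sum>\<tau>=0..<T. Z (p \<tau>) (p (Suc \<tau>)))"
  using assms unfolding reach_def walk_weight_def by (auto simp: atLeast0LessThan)

text \<open>Pigeonhole: there are \<open>n + 1\<close> times and only \<open>n\<close>
  nodes.\<close>

lemma closed_subwalk:
  assumes "\<And>t. t \<le> T \<Longrightarrow> p t < (n::nat)" "a + n \<le> T"
  obtains s t where "a \<le> s" "s < t" "t \<le> a + n" "p s = p t"
proof -
  have "\<not> inj_on p {a..a + n}"
  proof
    assume "inj_on p {a..a + n}"
    moreover have "p ` {a..a + n} \<subseteq> {..<n}" using assms by auto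
    ultimately have "card {a..a + n} \<le> card {..<n}" by (intro card_inj_on_le) auto
    then show False by simp
  qed
  then obtain x y where "x \<in> {a..a + n}" "y \<in> {a..a + n}" "x \<noteq> y" "p x = p y"
    unfolding inj_on_def by blast
  then show ?thesis using that[of x y] that[of y x] by (cases "x < y") auto
qed

section \<open>Shifting walks in time by deleting and repeating cycles\<close>

lemma frequent_value:
  fixes f :: "nat \<Rightarrow> nat"
  assumes "\<And>b. b < n * D \<Longrightarrow> f b \<in> {1..n}" "n > 0"
  obtains y where "y \<in> {1..n}" "D \<le> card {b. b < n * D \<and> f b = y}"
proof (rule ccontr)
  note witness = that
  assume no: "\<not> thesis"
  have lt: "card {b. b < n * D \<and> f b = y} < D" if "y \<in> {1..n}" for y
    using no witness[OF that] by (meson linorder_not_less)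
  have "{..<n * D} = (\<Union>y\<in>{1..n}. {b. b < n * D \<and> f b = y})" using assms(1) by auto
  then have "n * D = card (\<Union>y\<in>{1..n}. {b. b < n * D \<and> f b = y})" by (metis card_lessThan)
  also have "\<dots> \<le> (\<Sum>y\<in>{1..n}. card {b. b < n * D \<and> f b = y})" by (rule card_UN_le) simp
  also have "\<dots> < (\<Sum>y\<in>{1..n}. D)" using lt assms(2) by (intro sum_strict_mono) auto
  finally show False by simp
qed

text \<open>Among \<open>n D\<close> blocks of length \<open>n\<close>, many contain a cycle of the same length \<open>l\<close>. Deleting \<open>D / l\<close> of these
  costs \<open>\<mu>\<close>, and repeating the heaviest of them \<open>D / l\<close> times gains at least \<open>\<mu>\<close>.\<close>

lemma window_shift:
  assumes "n > 0" "\<And>l. l \<in> {1..n} \<Longrightarrow> l dvd D" "D > 0" "reach_pow n Z (n * (n * D)) i j C"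
  obtains \<mu> where "reach_pow n Z (n * (n * D) - D) i j (C - \<mu>)"
    "reach_pow n Z (n * (n * D) + D) i j (C + \<mu>)"
proof -
  define w where "w = n * (n * D)"
  obtain p where p: "\<And>t. t \<le> w \<Longrightarrow> p t < n" "p 0 = i" "p w = j"
    "C \<le> (\<Sum>\<tau>=0..<w. Z (p \<tau>) (p (Suc \<tau>)))" using reach_powE[OF assms(4)] unfolding w_def by metis
  define wt where "wt = (\<lambda>s t. \<Sum>\<tau>=s..<t. Z (p \<tau>) (p (Suc \<tau>)))"
  have wt_split: "wt s u = wt s t + wt t u" if "s \<le> t" "t \<le> u" for s t u
    unfolding wt_def using that by (simp add: sum.atLeastLessThan_concat)
  have seg: "reach_pow n Z (t - s) (p s) (p t) (wt s t)" if "s \<le> t" "t \<le> w" for s t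
    unfolding wt_def by (rule reach_pow_segment[OF p(1) that])
  have block_le: "n * b + n \<le> w" if "b < n * D" for b
    using mult_le_mono2[of "Suc b" "n * D" n] that unfolding w_def by simp
  have "\<exists>s t. n * b \<le> s \<and> s < t \<and> t \<le> n * b + n \<and> p s = p t" if "b < n * D" for b
    by (rule closed_subwalk[OF p(1) block_le[OF that]]) blast+
  then obtain s t where st: "\<And>b. b < n * D \<Longrightarrow> n * b \<le> s b" "\<And>b. b < n * D \<Longrightarrow> s b < t b"
    "\<And>b. b < n * D \<Longrightarrow> t b \<le> n * b + n" "\<And>b. b < n * D \<Longrightarrow> p (s b) = p (t b)" by metis
  obtain l where l: "l \<in> {1..n}" "D \<le> card {b. b < n * D \<and> t b - s b = l}"
  proof (rule frequent_value[of n D "\<lambda>b. t b - s b"])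
    show "t b - s b \<in> {1..n}" if "b < n * D" for b
    proof -
      have "s b < t b" "t b \<le> s b + n" using st(1-3)[OF that] by linarith+
      then show ?thesis unfolding atLeastAtMost_iff by arith
    qed
  qed (use assms(1) in auto)
  \<comment> \<open>Together, \<open>r\<close> cycles of length \<open>l\<close> have length
    \<open>D\<close>. Those indexed by \<open>G\<close> lie in different blocks, so they can be
    deleted independently.\<close>
  define r where "r = D div l"
  have r: "r * l = D" using assms(2)[OF l(1)] by (simp add: r_def)
  then have r0: "r > 0" using assms(3) by (intro Nat.gr0I) auto
  have rD: "r \<le> D" by (simp add: r_def)
  obtain G where G: "G \<subseteq> {b. b < n * D \<and> t b - s b = l}" "card G = r"
    using obtain_subset_with_card_n[of r] l(2) rD by (meson le_trans)
  have finG: "finite G" using G(1) by (rule finite_subset) simp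
  define \<mu> where "\<mu> = (\<Sum>b\<in>G. wt (s b) (t b))"
  define len where "len = (\<lambda>b. if b \<in> G then n - l else n)"
  define c where "c = (\<lambda>b. wt (n * b) (n * b + n) - (if b \<in> G then wt (s b) (t b) else 0))"
  have GI: "{..<n * D} \<inter> G = G" using G(1) by auto
  have wt_sum: "wt 0 (n * m) = (\<Sum>b<m. wt (n * b) (n * b + n))" for m
  proof (induction m)
    case (Suc m)
    then show ?case using wt_split[of 0 "n * m" "n * m + n"] by (simp add: add.commute)
  qed (simp add: wt_def)
  have "reach_pow n Z (\<Sum>b<n * D. len b) (p (n * 0)) (p (n * (n * D))) (\<Sum>b<n * D. c b)"
  proof (rule reach_pow_sum[where x = "\<lambda>b. p (n * b)"])
    fix b assume b: "b < n * D"
    show "reach_pow n Z (len b) (p (n * b)) (p (n * Suc b)) (c b)"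
    proof (cases "b \<in> G")
      case True
      have bl: "t b - s b = l" using True G(1) by auto
      have "reach_pow n Z ((s b - n * b) + (n * b + n - t b)) (p (n * b)) (p (n * b + n))
          (wt (n * b) (s b) + wt (t b) (n * b + n))"
        by (rule reach_pow_add[OF seg]) (use seg[of "t b" "n * b + n"] st[OF b] block_le[OF b] in auto)
      moreover have "(s b - n * b) + (n * b + n - t b) = len b"
        using True bl st(1-3)[OF b] by (simp add: len_def)
      moreover have "wt (n * b) (s b) + wt (t b) (n * b + n) = c b"
        using wt_split[of "n * b" "s b" "n * b + n"] wt_split[of "s b" "t b" "n * b + n"] st(1-3)[OF b] True
        by (simp add: c_def)
      ultimately show ?thesis by (simp add: add.commute)
    next
      case False
      then show ?thesis using seg[of "n * b" "n * b + n"] block_le[OF b]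
        by (simp add: len_def c_def add.commute)
    qed
  qed (use p in auto)
  moreover have "(\<Sum>b<n * D. len b) = w - D"
  proof -
    have "(\<Sum>b<n * D. len b) + (\<Sum>b<n * D. if b \<in> G then l else 0) = (\<Sum>b<n * D. n)"
      unfolding sum.distrib[symmetric] by (rule sum.cong) (use l(1) in \<open>auto simp: len_def\<close>)
    moreover have "(\<Sum>b<n * D. if b \<in> G then l else 0) = D"
      using r G(2) by (simp add: sum.If_cases GI)
    ultimately show ?thesis by (simp add: w_def mult.commute)
  qed
  moreover have "(\<Sum>b<n * D. c b) = wt 0 w - \<mu>"
    unfolding c_def sum_subtractf \<mu>_def w_def wt_sum by (simp add: sum.If_cases GI)
  ultimately have del: "reach_pow n Z (w - D) i j (wt 0 w - \<mu>)"
    using p by (simp add: w_def)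
  \<comment> \<open>Averaging: some cycle in \<open>G\<close> weighs at least
    \<open>\<mu> / r\<close>.\<close>
  obtain b where b: "b \<in> G" "\<mu> \<le> real r * wt (s b) (t b)"
  proof (rule ccontr)
    note witness = that
    assume no: "\<not> thesis"
    have "wt (s b) (t b) < \<mu> / r" if "b \<in> G" for b
    proof -
      have "\<not> \<mu> \<le> real r * wt (s b) (t b)" using no witness[OF that] by blast
      then show ?thesis using r0 by (simp add: pos_less_divide_eq mult.commute)
    qed
    then have "\<mu> < (\<Sum>b\<in>G. \<mu> / r)"
      unfolding \<mu>_def using finG G(2) r0 by (intro sum_strict_mono) auto
    then show False using G(2) r0 by simp
  qed
  have bD: "b < n * D" "t b - s b = l" using b(1) G(1) by auto
  have tw: "t b \<le> w" using st(3)[OF bD(1)] block_le[OF bD(1)] by simp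
  have "reach_pow n Z (\<Sum>a<r. l) (p (s b)) (p (s b)) (\<Sum>a<r. wt (s b) (t b))"
    by (rule reach_pow_sum[where x = "\<lambda>_. p (s b)"])
      (use seg[of "s b" "t b"] st[OF bD(1)] bD(2) tw p(1)[of "s b"] in auto)
  then have loop: "reach_pow n Z D (p (s b)) (p (s b)) \<mu>"
    using r b(2) by (simp add: reach_mono)
  have "reach_pow n Z (s b - 0 + D + (w - s b)) (p 0) (p w) (wt 0 (s b) + \<mu> + wt (s b) w)"
    by (rule reach_pow_add[OF reach_pow_add[OF seg loop] seg]) (use st[OF bD(1)] tw in auto)
  moreover have "s b - 0 + D + (w - s b) = w + D" using st(2)[OF bD(1)] tw by simp
  moreover have "wt 0 (s b) + \<mu> + wt (s b) w = wt 0 w + \<mu>"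
    using wt_split[of 0 "s b" w] st(2)[OF bD(1)] tw by simp
  ultimately have ins: "reach_pow n Z (w + D) i j (wt 0 w + \<mu>)" using p(2,3) by metis
  show ?thesis
    by (rule that[of \<mu>])
      (use del ins p(4) in \<open>auto simp: wt_def w_def intro: reach_mono\<close>)
qed

text \<open>\<open>\<mu> a\<close> is the shift weight that \<open>window_shift\<close> gives for
  window \<open>a\<close>. Lengthening a single window will serve to bound each
  \<open>\<mu> a\<close>; shortening the first \<open>e\<close> windows at once makes room for
  inserted walks.\<close>

lemma windows_shift:
  assumes "n > 0" "\<And>l. l \<in> {1..n} \<Longrightarrow> l dvd D" "D > 0" "reach_pow n Z (N * (n * (n * D))) i j C"
  obtains \<mu> where "\<And>a. a < N \<Longrightarrow> reach_pow n Z (N * (n * (n * D)) + D) i j (C + \<mu> a)"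
    "\<And>e. e \<le> N \<Longrightarrow> reach_pow n Z (N * (n * (n * D)) - e * D) i j (C - (\<Sum>a<e. \<mu> a))"
  using assms(4)
proof (induction N arbitrary: j C thesis)
  case 0
  then show ?case by simp
next
  case (Suc N)
  let ?w = "n * (n * D)"
  have wD: "D \<le> ?w" using assms(1) by simp
  have NwD: "N * D \<le> N * ?w" using wD by (rule mult_le_mono2)
  have "replicate (Suc N * ?w) () = replicate (N * ?w) () @ replicate ?w ()"
    by (simp add: replicate_add[symmetric] add.commute)
  then have "reach n (\<lambda>_. Z) (replicate (N * ?w) () @ replicate ?w ()) i j C"
    using Suc.prems(2) by metis
  then obtain k c d where kcd: "reach_pow n Z (N * ?w) i k c" "reach_pow n Z ?w k j d" "C \<le> c + d"
    by (rule reach_appendE)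
  obtain \<mu> where \<mu>: "\<And>a. a < N \<Longrightarrow> reach_pow n Z (N * ?w + D) i k (c + \<mu> a)"
    "\<And>e. e \<le> N \<Longrightarrow> reach_pow n Z (N * ?w - e * D) i k (c - (\<Sum>a<e. \<mu> a))"
    using Suc.IH[OF _ kcd(1)] by blast
  obtain \<nu> where \<nu>: "reach_pow n Z (?w - D) k j (d - \<nu>)" "reach_pow n Z (?w + D) k j (d + \<nu>)"
    using window_shift[OF assms(1-3) kcd(2)] by blast
  show ?case
  proof (rule Suc.prems(1)[of "\<mu>(N := \<nu>)"])
    fix a assume "a < Suc N"
    show "reach_pow n Z (Suc N * ?w + D) i j (C + (\<mu>(N := \<nu>)) a)"
    proof (cases "a = N")
      case True
      have "reach_pow n Z (N * ?w + (?w + D)) i j (c + (d + \<nu>))"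
        by (rule reach_pow_add[OF kcd(1) \<nu>(2)])
      then show ?thesis using True kcd(3) by (simp add: add_ac reach_mono)
    next
      case False
      have "reach_pow n Z ((N * ?w + D) + ?w) i j ((c + \<mu> a) + d)"
        by (rule reach_pow_add[OF \<mu>(1) kcd(2)]) (use False \<open>a < Suc N\<close> in simp)
      then show ?thesis using False kcd(3) by (simp add: add_ac reach_mono)
    qed
  next
    fix e assume "e \<le> Suc N"
    show "reach_pow n Z (Suc N * ?w - e * D) i j (C - (\<Sum>a<e. (\<mu>(N := \<nu>)) a))"
    proof (cases "e = Suc N")
      case True
      have "reach_pow n Z ((N * ?w - N * D) + (?w - D)) i j ((c - (\<Sum>a<N. \<mu> a)) + (d - \<nu>))"
        by (rule reach_pow_add[OF \<mu>(2) \<nu>(1)]) simp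
      moreover have "(N * ?w - N * D) + (?w - D) = Suc N * ?w - e * D"
        using True wD NwD by simp
      moreover have "(\<Sum>a<e. (\<mu>(N := \<nu>)) a) = (\<Sum>a<N. \<mu> a) + \<nu>" using True by simp
      ultimately show ?thesis using kcd(3) by (auto intro: reach_mono)
    next
      case False
      then have e: "e \<le> N" using \<open>e \<le> Suc N\<close> by simp
      have "reach_pow n Z ((N * ?w - e * D) + ?w) i j ((c - (\<Sum>a<e. \<mu> a)) + d)"
        by (rule reach_pow_add[OF \<mu>(2)[OF e] kcd(2)])
      moreover have "(N * ?w - e * D) + ?w = Suc N * ?w - e * D"
        using order_trans[OF mult_le_mono1[OF e, of D] NwD] by simp
      moreover have "(\<Sum>a<e. (\<mu>(N := \<nu>)) a) = (\<Sum>a<e. \<mu> a)" using e by (intro sum.cong) auto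
      ultimately show ?thesis using kcd(3) by (auto intro: reach_mono)
    qed
  qed
qed

text \<open>An optimal walk for which \<open>k\<close> is unavoidable at time \<open>W\<close> consists of \<open>N\<close> windows, a centre of length \<open>D\<close>
  starting at \<open>k\<close>, and \<open>N\<close> windows. Moving a shift of length \<open>D\<close> between the sides shows that the centre
  is closed at \<open>k\<close>, and comparing with the centre shows that no shift weighs more than it. A heavy closed walk
  through \<open>q \<noteq> k\<close> could then be inserted, at the cost of deletions in the windows, so as to pass
  \<open>q\<close> at time \<open>W\<close>.\<close>

lemma closed_walk_strict:
  assumes n: "n \<ge> 2" and D: "\<And>l. l \<in> {1..n} \<Longrightarrow> l dvd D" "D > 0" and N: "N > 0"
    and T: "T = N * (n * (n * D)) + D + N * (n * (n * D))"
    and full: "\<not> low_rank n (word_val n (\<lambda>_. Z) (replicate T ()))"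
    and k: "k < n" and q: "q \<noteq> k" and e: "e1 \<le> N" "e2 \<le> N"
    and c1: "reach_pow n Z (e1 * D) k q c1" and c2: "reach_pow n Z (e2 * D) q k c2"
  shows "c1 + c2 < (e1 + e2) * word_val n (\<lambda>_. Z) (replicate D ()) k k"
proof (rule ccontr)
  define W where "W = N * (n * (n * D))"
  define \<zeta> where "\<zeta> = word_val n (\<lambda>_. Z) (replicate D ()) k k"
  assume "\<not> ?thesis"
  then have ge: "(e1 + e2) * \<zeta> \<le> c1 + c2" by (simp add: \<zeta>_def)
  have n0: "n > 0" using n by simp
  have W0: "W > 0" using n0 D(2) N by (simp add: W_def)
  have ND: "N * D \<le> W" unfolding W_def using n0 by (intro mult_le_mono2) simp
  have eW: "e * D \<le> W" if "e \<le> N" for e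
    using order_trans[OF mult_le_mono1[OF that, of D] ND] .
  have T': "T = W + (D + W)" using T by (simp add: W_def)
  have vT: "word_val n (\<lambda>_. Z) (replicate T ()) = maxplus_mult n (word_val n (\<lambda>_. Z) (replicate W ()))
      (word_val n (\<lambda>_. Z) (replicate (D + W) ()))"
    unfolding T' replicate_add[of W] by (rule word_val_append) (use n0 W0 in auto)
  obtain i j where ij: "i < n" "j < n" and st: "\<And>l. l < n \<Longrightarrow> l \<noteq> k \<Longrightarrow>
      word_val n (\<lambda>_. Z) (replicate W ()) i l + word_val n (\<lambda>_. Z) (replicate (D + W) ()) l j
      < word_val n (\<lambda>_. Z) (replicate T ()) i j"
    using strict_node_if_not_low_rank[OF n full[unfolded vT] k] unfolding vT by metis
  define V where "V = word_val n (\<lambda>_. Z) (replicate T ()) i j"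
  have opt: "c \<le> V" if "reach_pow n Z t i j c" "t = T" for c t
    using reach_le_word_val[OF that(1)] that(2) W0 T' by (simp add: V_def)
  \<comment> \<open>Every optimal walk from \<open>i\<close> to \<open>j\<close> is at
    \<open>k\<close> at time \<open>W\<close>. The rest of the proof builds optimal walks with other
    nodes at that time.\<close>
  have strict: "l = k" if "reach_pow n Z s i l c" "reach_pow n Z t l j d" "s = W" "t = D + W" "V \<le> c + d"
    for l c d s t
  proof (rule ccontr)
    assume "l \<noteq> k"
    then have "word_val n (\<lambda>_. Z) (replicate W ()) i l + word_val n (\<lambda>_. Z) (replicate (D + W) ()) l j < V"
      unfolding V_def using reach_lt[OF that(1)] by (intro st) auto
    moreover have "c \<le> word_val n (\<lambda>_. Z) (replicate W ()) i l"
      by (rule reach_le_word_val) (use that W0 in auto)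
    moreover have "d \<le> word_val n (\<lambda>_. Z) (replicate (D + W) ()) l j"
      by (rule reach_le_word_val) (use that W0 in auto)
    ultimately show False using that(5) by simp
  qed
  have "reach_pow n Z T i j V"
    unfolding V_def by (rule reach_word_val) (use ij T' W0 in auto)
  then have "reach n (\<lambda>_. Z) (replicate W () @ replicate (D + W) ()) i j V"
    by (simp add: T' replicate_add)
  then obtain k0 C d where k0: "reach_pow n Z W i k0 C" "reach_pow n Z (D + W) k0 j d" "V \<le> C + d"
    by (rule reach_appendE)
  have "k0 = k" by (rule strict[OF k0(1,2) refl refl k0(3)])
  then have left: "reach_pow n Z W i k C" using k0(1) by simp
  from k0(2) \<open>k0 = k\<close> have "reach n (\<lambda>_. Z) (replicate D () @ replicate W ()) k j d"
    by (simp add: replicate_add)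
  then obtain k' \<kappa> C' where k': "reach_pow n Z D k k' \<kappa>" "reach_pow n Z W k' j C'" "d \<le> \<kappa> + C'"
    by (rule reach_appendE)
  have V: "V \<le> C + \<kappa> + C'" using k0(3) k'(3) by simp
  obtain \<mu> where \<mu>: "\<And>a. a < N \<Longrightarrow> reach_pow n Z (W + D) i k (C + \<mu> a)"
    "\<And>e. e \<le> N \<Longrightarrow> reach_pow n Z (W - e * D) i k (C - (\<Sum>a<e. \<mu> a))"
    using windows_shift[OF n0 D left[unfolded W_def]] unfolding W_def by blast
  obtain \<nu> where \<nu>: "\<And>a. a < N \<Longrightarrow> reach_pow n Z (W + D) k' j (C' + \<nu> a)"
    "\<And>e. e \<le> N \<Longrightarrow> reach_pow n Z (W - e * D) k' j (C' - (\<Sum>a<e. \<nu> a))"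
    using windows_shift[OF n0 D k'(2)[unfolded W_def]] unfolding W_def by blast
  have N1: "Suc 0 \<le> N" using N by simp
  \<comment> \<open>If \<open>\<mu> 0 \<le> \<nu> 0\<close>, shortening the left and lengthening the
    right loses nothing and puts \<open>k'\<close> at time \<open>W\<close>; otherwise the reverse
    exchange beats \<open>V\<close>.\<close>
  have "k' = k"
  proof (cases "\<mu> 0 \<le> \<nu> 0")
    case True
    have "reach_pow n Z ((W - D) + D) i k' ((C - \<mu> 0) + \<kappa>)"
      using reach_pow_add[OF \<mu>(2)[OF N1] k'(1)] by simp
    then show ?thesis
      using \<nu>(1)[OF N] by (rule strict) (use eW[OF N1] V True in auto)
  next
    case False
    have "reach_pow n Z ((W + D) + D + (W - D)) i j (((C + \<mu> 0) + \<kappa>) + (C' - \<nu> 0))"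
      using reach_pow_add[OF reach_pow_add[OF \<mu>(1)[OF N] k'(1)] \<nu>(2)[OF N1]] by simp
    from opt[OF this] have "((C + \<mu> 0) + \<kappa>) + (C' - \<nu> 0) \<le> V" using eW[OF N1] T' by simp
    then show ?thesis using V False by simp
  qed
  note right = \<nu>[unfolded \<open>k' = k\<close>] and loop = k'(1)[unfolded \<open>k' = k\<close>]
    and right0 = k'(2)[unfolded \<open>k' = k\<close>]
  have "C + \<mu> a + C' \<le> V" if "a < N" for a
    by (rule opt[OF reach_pow_add[OF \<mu>(1)[OF that] right0]]) (simp add: T')
  then have \<mu>\<kappa>: "\<mu> a \<le> \<kappa>" if "a < N" for a using V that by fastforce
  have "C + (C' + \<nu> a) \<le> V" if "a < N" for a
    by (rule opt[OF reach_pow_add[OF left right(1)[OF that]]]) (simp add: T')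
  then have \<nu>\<kappa>: "\<nu> a \<le> \<kappa>" if "a < N" for a using V that by fastforce
  \<comment> \<open>The bound assumed for \<open>\<zeta>\<close> thereby passes to
    \<open>\<kappa>\<close>, which bounds the cost of each deletion.\<close>
  have "\<kappa> \<le> \<zeta>" unfolding \<zeta>_def by (rule reach_le_word_val[OF loop]) (use D(2) in auto)
  then have ge': "e1 * \<kappa> + e2 * \<kappa> \<le> c1 + c2"
    using ge mult_left_mono[of \<kappa> \<zeta> "real (e1 + e2)"] by (simp add: algebra_simps)
  have s1: "(\<Sum>a<e1. \<mu> a) \<le> e1 * \<kappa>" using sum_bounded_above[of "{..<e1}" \<mu> \<kappa>] \<mu>\<kappa> e by simp
  have s2: "(\<Sum>a<e2. \<nu> a) \<le> e2 * \<kappa>" using sum_bounded_above[of "{..<e2}" \<nu> \<kappa>] \<nu>\<kappa> e by simp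
  have "q = k"
  proof (rule strict)
    show "reach_pow n Z ((W - e1 * D) + e1 * D) i q ((C - (\<Sum>a<e1. \<mu> a)) + c1)"
      by (rule reach_pow_add[OF \<mu>(2)[OF e(1)] c1])
    show "reach_pow n Z (e2 * D + (D + (W - e2 * D))) q j (c2 + (\<kappa> + (C' - (\<Sum>a<e2. \<nu> a))))"
      by (rule reach_pow_add[OF c2 reach_pow_add[OF loop right(2)[OF e(2)]]])
    show "V \<le> C - (\<Sum>a<e1. \<mu> a) + c1 + (c2 + (\<kappa> + (C' - (\<Sum>a<e2. \<nu> a))))"
      using V s1 s2 ge' by simp
  qed (use eW[OF e(1)] eW[OF e(2)] in auto)
  then show False using q by simp
qed

section \<open>Dominant diagonals\<close>

text \<open>The max-plus permanent of \<open>X\<close> is attained by the identity alone: tropical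
  nonsingularity with the diagonal as the unique optimal assignment.\<close>

definition perm_dominant :: "nat \<Rightarrow> rmat \<Rightarrow> bool" where
  "perm_dominant n X \<longleftrightarrow>
     (\<forall>\<pi>. \<pi> permutes {..<n} \<longrightarrow> \<pi> \<noteq> id \<longrightarrow> (\<Sum>k<n. X k (\<pi> k)) < (\<Sum>k<n. X k k))"

text \<open>The orbit of \<open>k\<close> closes after some number of steps in
  \<open>{1..n}\<close>, and this number divides \<open>D\<close>.\<close>

lemma permutes_funpow_fixed:
  assumes "\<pi> permutes {..<n}" "k < n" "\<And>l. l \<in> {1..n} \<Longrightarrow> l dvd D"
  shows "(\<pi> ^^ D) k = k"
proof -
  have lt: "(\<pi> ^^ t) k < n" for t
    using permutes_in_image[OF assms(1)] assms(2) by (induction t) auto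
  obtain s t where st: "0 \<le> s" "s < t" "t \<le> 0 + n" "(\<pi> ^^ s) k = (\<pi> ^^ t) k"
    using closed_subwalk[of n "\<lambda>t. (\<pi> ^^ t) k" n 0] lt by auto
  have "(\<pi> ^^ s) ((\<pi> ^^ (t - s)) k) = (\<pi> ^^ s) k"
    using st(2,4) by (metis comp_apply funpow_add le_add_diff_inverse less_imp_le)
  then have fix1: "(\<pi> ^^ (t - s)) k = k"
    using inj_fn[OF permutes_inj[OF assms(1)], of s] by (auto dest: injD)
  have "t - s \<in> {1..n}" using st unfolding atLeastAtMost_iff by arith
  then obtain m where m: "D = (t - s) * m" using assms(3) by blast
  have "((\<pi> ^^ (t - s)) ^^ m) k = k" by (induction m) (auto simp: fix1)
  then show ?thesis by (simp add: funpow_mult m)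
qed

text \<open>Following \<open>\<pi>\<close> for \<open>D\<close> steps from each node gives closed
  walks, strictly lighter than \<open>D\<close> loops wherever \<open>\<pi>\<close> moves the
  starting node. Summed over all starting nodes, each time step contributes the weight of
  \<open>\<pi>\<close> once, since the current positions are permuted by a power of
  \<open>\<pi>\<close>.\<close>

lemma perm_dominant_if_closed_walks:
  assumes D: "\<And>l. l \<in> {1..n} \<Longrightarrow> l dvd D" "D > 0"
    and closed: "\<And>k q c d. k < n \<Longrightarrow> q \<noteq> k \<Longrightarrow> reach_pow n X 1 k q c \<Longrightarrow>
      reach_pow n X (D - 1) q k d \<Longrightarrow> c + d < D * X k k"
  shows "perm_dominant n X"
  unfolding perm_dominant_def
proof (intro allI impI)
  fix \<pi> assume \<pi>: "\<pi> permutes {..<n}" "\<pi> \<noteq> id"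
  have lt: "(\<pi> ^^ t) k < n" if "k < n" for t k
    using permutes_in_image[OF \<pi>(1)] that by (induction t) auto
  define s where "s = (\<lambda>k. \<Sum>t<D. X ((\<pi> ^^ t) k) ((\<pi> ^^ Suc t) k))"
  have less: "s k < D * X k k" if "k < n" "\<pi> k \<noteq> k" for k
  proof -
    have "reach_pow n X 1 k (\<pi> k) (X k (\<pi> k))"
      using reach_single[of k n "\<pi> k" "\<lambda>_. X" "()"] that lt[of k 1] by simp
    moreover have "reach_pow n X (D - 1) (\<pi> k) k (\<Sum>t<D - 1. X ((\<pi> ^^ Suc t) k) ((\<pi> ^^ Suc (Suc t)) k))"
    proof (rule reachI[of _ "\<lambda>t. (\<pi> ^^ Suc t) k"])
      show "(\<pi> ^^ Suc (length (replicate (D - 1) ()))) k = k"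
        using permutes_funpow_fixed[OF \<pi>(1) that(1) D(1)] D(2) by simp
    qed (use lt[OF that(1), of "Suc _"] in \<open>auto simp: walk_weight_def\<close>)
    moreover have "s k = X k (\<pi> k) + (\<Sum>t<D - 1. X ((\<pi> ^^ Suc t) k) ((\<pi> ^^ Suc (Suc t)) k))"
      using D(2) sum.lessThan_Suc_shift[of "\<lambda>t. X ((\<pi> ^^ t) k) ((\<pi> ^^ Suc t) k)" "D - 1"]
      by (simp add: s_def)
    ultimately show ?thesis using closed[of k "\<pi> k"] that by simp
  qed
  have fixed: "s k = D * X k k" if "\<pi> k = k" for k
  proof -
    have "(\<pi> ^^ t) k = k" for t by (induction t) (auto simp: that)
    then show ?thesis by (simp add: s_def that)
  qed
  obtain k where "\<pi> k \<noteq> k" using \<pi>(2) by (metis eq_id_iff)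
  then have "k < n" using \<pi>(1) by (meson lessThan_iff permutes_not_in)
  have "(\<Sum>k<n. s k) < (\<Sum>k<n. D * X k k)"
  proof (rule sum_strict_mono_ex1)
    show "\<forall>k\<in>{..<n}. s k \<le> D * X k k" using less fixed by (metis lessThan_iff less_imp_le order_refl)
    show "\<exists>k\<in>{..<n}. s k < D * X k k" using less \<open>k < n\<close> \<open>\<pi> k \<noteq> k\<close> by blast
  qed simp
  moreover have "(\<Sum>k<n. s k) = (\<Sum>t<D. \<Sum>k<n. X ((\<pi> ^^ t) k) (\<pi> ((\<pi> ^^ t) k)))"
    unfolding s_def by (subst sum.swap) simp
  moreover have "(\<Sum>k<n. X ((\<pi> ^^ t) k) (\<pi> ((\<pi> ^^ t) k))) = (\<Sum>k<n. X k (\<pi> k))" for t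
  proof -
    have "(\<pi> ^^ t) permutes {..<n}" using \<pi>(1) by (rule permutes_funpow)
    then show ?thesis using sum.permute[of "\<pi> ^^ t" "{..<n}" "\<lambda>k. X k (\<pi> k)"] by (simp add: comp_def)
  qed
  ultimately have "D * (\<Sum>k<n. X k (\<pi> k)) < D * (\<Sum>k<n. X k k)"
    by (simp add: sum_distrib_left)
  then show "(\<Sum>k<n. X k (\<pi> k)) < (\<Sum>k<n. X k k)" using D(2) by simp
qed

text \<open>\<open>f\<close> and \<open>g\<close> are the positions of \<open>n\<close> pairwise
  disjoint walks before and after one step. The step is then the permutation \<open>\<pi>\<close>
  sending \<open>f k\<close> to \<open>g k\<close>, to which dominance applies.\<close>

lemma perm_dominant_step:
  assumes X: "perm_dominant n X"
    and f: "inj_on f {..<n}" "f ` {..<n} \<subseteq> {..<n}" and g: "inj_on g {..<n}" "g ` {..<n} \<subseteq> {..<n}"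
  shows "(\<Sum>k<n. X (f k) (g k)) \<le> (\<Sum>k<n. X k k)"
    and "(\<Sum>k<n. X (f k) (g k)) = (\<Sum>k<n. X k k) \<Longrightarrow> k < n \<Longrightarrow> g k = f k"
proof -
  have bf: "bij_betw f {..<n} {..<n}" using f by (simp add: bij_betw_def endo_inj_surj)
  have bg: "bij_betw g {..<n} {..<n}" using g by (simp add: bij_betw_def endo_inj_surj)
  define \<pi> where "\<pi> = (\<lambda>i. if i < n then g (inv_into {..<n} f i) else i)"
  have "bij_betw (g \<circ> inv_into {..<n} f) {..<n} {..<n}"
    by (rule bij_betw_trans[OF bij_betw_inv_into[OF bf] bg])
  then have "bij_betw \<pi> {..<n} {..<n}" by (rule bij_betw_cong[THEN iffD1, rotated]) (simp add: \<pi>_def)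
  then have \<pi>: "\<pi> permutes {..<n}" by (rule bij_imp_permutes) (simp add: \<pi>_def)
  have \<pi>f: "\<pi> (f k) = g k" if "k < n" for k
    using that f by (auto simp: \<pi>_def image_subset_iff)
  have eq: "(\<Sum>k<n. X (f k) (g k)) = (\<Sum>k<n. X k (\<pi> k))"
    using sum.reindex_bij_betw[OF bf, of "\<lambda>k. X k (\<pi> k)"] \<pi>f by simp
  show "(\<Sum>k<n. X (f k) (g k)) \<le> (\<Sum>k<n. X k k)"
    unfolding eq by (cases "\<pi> = id") (use X \<pi> in \<open>auto simp: perm_dominant_def less_imp_le\<close>)
  show "g k = f k" if "(\<Sum>k<n. X (f k) (g k)) = (\<Sum>k<n. X k k)" "k < n"
  proof -
    have "\<pi> = id" using X \<pi> that(1) unfolding eq perm_dominant_def by force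
    then show ?thesis using \<pi>f[OF that(2)] by simp
  qed
qed

lemma optimal_closed_walk_const:
  assumes w: "w \<noteq> []" and dom: "\<And>l. perm_dominant n (\<phi> l)"
    and two: "\<And>k q. k < n \<Longrightarrow> q < n \<Longrightarrow> k \<noteq> q \<Longrightarrow>
      word_val n \<phi> w k q + word_val n \<phi> w q k < 2 * word_val n \<phi> w k k"
    and p: "\<And>t. t \<le> length w \<Longrightarrow> p t < n" "p 0 = k" "p (length w) = k"
      "word_val n \<phi> w k k \<le> walk_weight \<phi> w p"
    and t: "t \<le> length w"
  shows "p t = k"
proof -
  let ?M = "word_val n \<phi> w"
  have "\<exists>p. (\<forall>t\<le>length w. p t < n) \<and> p 0 = l \<and> p (length w) = l \<and> walk_weight \<phi> w p = ?M l l"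
    if "l < n" for l
    by (rule optimal_walk[OF w that that, of \<phi>]) blast
  then obtain \<gamma>' where \<gamma>': "\<And>l t. l < n \<Longrightarrow> t \<le> length w \<Longrightarrow> \<gamma>' l t < n" "\<And>l. l < n \<Longrightarrow> \<gamma>' l 0 = l"
    "\<And>l. l < n \<Longrightarrow> \<gamma>' l (length w) = l" "\<And>l. l < n \<Longrightarrow> walk_weight \<phi> w (\<gamma>' l) = ?M l l"
    by metis
  \<comment> \<open>All nodes walk simultaneously: \<open>k\<close> along the given
    \<open>p\<close>, the others along arbitrary optimal closed walks.\<close>
  define \<gamma> where "\<gamma> = \<gamma>'(k := p)"
  have k: "k < n" using p(1)[of 0] p(2) by simp
  have "walk_weight \<phi> w p \<le> ?M (p 0) (p (length w))" by (rule walk_weight_le_word_val[OF w p(1)])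
  then have pk: "walk_weight \<phi> w p = ?M k k" using p by simp
  have \<gamma>: "\<And>l t. l < n \<Longrightarrow> t \<le> length w \<Longrightarrow> \<gamma> l t < n" "\<And>l. l < n \<Longrightarrow> \<gamma> l 0 = l"
    "\<And>l. l < n \<Longrightarrow> \<gamma> l (length w) = l" "\<And>l. l < n \<Longrightarrow> walk_weight \<phi> w (\<gamma> l) = ?M l l"
    using \<gamma>' p pk by (auto simp: \<gamma>_def)
  have inj: "inj_on (\<lambda>l. \<gamma> l s) {..<n}" if s: "s \<le> length w" for s
  proof (rule inj_onI, rule ccontr)
    fix a b assume ab: "a \<in> {..<n}" "b \<in> {..<n}" "\<gamma> a s = \<gamma> b s" "a \<noteq> b"
    \<comment> \<open>If the walks of \<open>a\<close> and \<open>b\<close> meet at time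
      \<open>s\<close>, swapping their tails keeps the joint weight and yields walks from
      \<open>a\<close> to \<open>b\<close> and from \<open>b\<close> to \<open>a\<close>. Adding
      \<open>two\<close> for both orders of \<open>a\<close> and \<open>b\<close> excludes
      this.\<close>
    define mix where "mix = (\<lambda>a b \<tau>. if \<tau> \<le> s then \<gamma> a \<tau> else \<gamma> b \<tau>)"
    have le: "walk_weight \<phi> w (mix a b) \<le> ?M a b" if "a < n" "b < n" "\<gamma> a s = \<gamma> b s" for a b
    proof -
      have "mix a b (length w) = b" using that \<gamma> s by (auto simp: mix_def)
      then show ?thesis
        using walk_weight_le_word_val[OF w, of "mix a b" n \<phi>] \<gamma>(1,2) that by (simp add: mix_def)
    qed
    have "walk_weight \<phi> w (mix a b) + walk_weight \<phi> w (mix b a)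
        = walk_weight \<phi> w (\<gamma> a) + walk_weight \<phi> w (\<gamma> b)"
      unfolding walk_weight_def sum.distrib[symmetric]
    proof (rule sum.cong[OF refl])
      fix \<tau>
      consider "Suc \<tau> \<le> s" | "\<tau> = s" | "\<tau> > s" by linarith
      then show "\<phi> (w ! \<tau>) (mix a b \<tau>) (mix a b (Suc \<tau>)) + \<phi> (w ! \<tau>) (mix b a \<tau>) (mix b a (Suc \<tau>))
        = \<phi> (w ! \<tau>) (\<gamma> a \<tau>) (\<gamma> a (Suc \<tau>)) + \<phi> (w ! \<tau>) (\<gamma> b \<tau>) (\<gamma> b (Suc \<tau>))"
        by cases (use ab(3) in \<open>auto simp: mix_def\<close>)
    qed
    then show False
      using le[of a b] le[of b a] two[of a b] two[of b a] \<gamma>(4)[of a] \<gamma>(4)[of b] ab by auto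
  qed
  have img: "(\<lambda>l. \<gamma> l s) ` {..<n} \<subseteq> {..<n}" if "s \<le> length w" for s using \<gamma>(1) that by auto
  have step_le: "(\<Sum>l<n. \<phi> (w ! s) (\<gamma> l s) (\<gamma> l (Suc s))) \<le> (\<Sum>l<n. \<phi> (w ! s) l l)"
    if "s < length w" for s
    by (rule perm_dominant_step(1)[OF dom inj img inj img]) (use that in auto)
  have "(\<Sum>s<length w. \<Sum>l<n. \<phi> (w ! s) (\<gamma> l s) (\<gamma> l (Suc s))) = (\<Sum>l<n. ?M l l)"
    by (subst sum.swap) (simp add: \<gamma>(4)[symmetric] walk_weight_def)
  moreover have "(\<Sum>s<length w. \<Sum>l<n. \<phi> (w ! s) l l) \<le> (\<Sum>l<n. ?M l l)"
    by (subst sum.swap, rule sum_mono)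
      (use diag_weight_le_word_val[OF _ w] in \<open>simp add: diag_weight_eq_sum\<close>)
  \<comment> \<open>Dominance bounds each step from above, and the constant walks bound the total
    from below, so every step attains its bound.\<close>
  ultimately have total: "(\<Sum>s<length w. \<Sum>l<n. \<phi> (w ! s) l l)
      \<le> (\<Sum>s<length w. \<Sum>l<n. \<phi> (w ! s) (\<gamma> l s) (\<gamma> l (Suc s)))" by simp
  have step_eq: "(\<Sum>l<n. \<phi> (w ! s) (\<gamma> l s) (\<gamma> l (Suc s))) = (\<Sum>l<n. \<phi> (w ! s) l l)"
    if "s < length w" for s
  proof (rule ccontr)
    assume "\<not> ?thesis"
    then have "(\<Sum>s<length w. \<Sum>l<n. \<phi> (w ! s) (\<gamma> l s) (\<gamma> l (Suc s)))
        < (\<Sum>s<length w. \<Sum>l<n. \<phi> (w ! s) l l)"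
      using step_le that by (intro sum_strict_mono_ex1) (auto intro!: bexI[of _ s] simp: less_le)
    then show False using total by simp
  qed
  have "\<gamma> k t = k" using t
  proof (induction t)
    case (Suc t)
    have "\<gamma> k (Suc t) = \<gamma> k t"
      by (rule perm_dominant_step(2)[OF dom inj img inj img step_eq k]) (use Suc.prems in auto)
    then show ?case using Suc by simp
  qed (simp add: \<gamma>(2) k)
  then show ?thesis by (simp add: \<gamma>_def)
qed

lemma diag_weight_power:
  "diag_weight \<phi> (subst_word (\<lambda>_. w) (replicate m ())) k = m * diag_weight \<phi> w k"
  by (induction m) (auto simp: algebra_simps)

text \<open>The inequality \<open>two\<close> is available only for powers. Constancy of the optimal
  closed walks of the power \<open>w @ r\<close> passes to its prefix \<open>w\<close>: a closed
  walk on \<open>w\<close> extends by waiting on \<open>r\<close>. A tie through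
  \<open>q \<noteq> k\<close> would give a non-constant optimal closed walk of the power.\<close>

lemma closed_words_diag:
  assumes w: "w \<noteq> []" and m: "m > 0" and dom: "\<And>l. perm_dominant n (\<phi> l)"
    and two: "\<And>k q. k < n \<Longrightarrow> q < n \<Longrightarrow> k \<noteq> q \<Longrightarrow>
      word_val n \<phi> (subst_word (\<lambda>_. w) (replicate m ())) k q + word_val n \<phi> (subst_word (\<lambda>_. w) (replicate m ())) q k
      < 2 * word_val n \<phi> (subst_word (\<lambda>_. w) (replicate m ())) k k"
  shows "k < n \<Longrightarrow> word_val n \<phi> w k k = diag_weight \<phi> w k"
    and "w = u @ v \<Longrightarrow> u \<noteq> [] \<Longrightarrow> v \<noteq> [] \<Longrightarrow> k < n \<Longrightarrow> q < n \<Longrightarrow> k \<noteq> q \<Longrightarrow>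
      word_val n \<phi> u k q + word_val n \<phi> v q k < diag_weight \<phi> w k"
proof -
  define r where "r = subst_word (\<lambda>_. w) (replicate (m - 1) ())"
  have W: "subst_word (\<lambda>_. w) (replicate m ()) = w @ r" using m by (cases m) (auto simp: r_def)
  note two' = two[unfolded W]
  have wr: "w @ r \<noteq> []" using w by simp
  have dr: "diag_weight \<phi> (w @ r) k = m * diag_weight \<phi> w k" for k
    using diag_weight_power[of \<phi> w m k] W by simp
  have eq: "word_val n \<phi> (w @ r) k k = diag_weight \<phi> (w @ r) k" if k: "k < n" for k
  proof -
    obtain p where p: "\<And>t. t \<le> length (w @ r) \<Longrightarrow> p t < n" "p 0 = k" "p (length (w @ r)) = k"
      "walk_weight \<phi> (w @ r) p = word_val n \<phi> (w @ r) k k"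
      using optimal_walk[OF wr k k] by metis
    have "p t = k" if "t \<le> length (w @ r)" for t
      by (rule optimal_closed_walk_const[OF wr dom two' p(1-3) _ that]) (use p(4) in auto)
    then have "walk_weight \<phi> (w @ r) p = walk_weight \<phi> (w @ r) (\<lambda>_. k)" by (rule walk_weight_cong)
    then show ?thesis using p(4) by (simp add: walk_weight_const)
  qed
  show "word_val n \<phi> w k k = diag_weight \<phi> w k" if k: "k < n" for k
  proof (rule antisym)
    have "reach n \<phi> (w @ r) k k (word_val n \<phi> w k k + diag_weight \<phi> r k)"
      by (rule reach_append[OF reach_word_val[OF w k k] reach_diag[OF k]])
    from reach_le_word_val[OF this wr] show "word_val n \<phi> w k k \<le> diag_weight \<phi> w k"
      unfolding eq[OF k] by simp
  qed (rule diag_weight_le_word_val[OF k w])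
  show "word_val n \<phi> u k q + word_val n \<phi> v q k < diag_weight \<phi> w k"
    if uv: "w = u @ v" "u \<noteq> []" "v \<noteq> []" and kq: "k < n" "q < n" "k \<noteq> q"
  proof (rule ccontr)
    assume "\<not> ?thesis"
    then have ge: "diag_weight \<phi> w k \<le> word_val n \<phi> u k q + word_val n \<phi> v q k" by simp
    have 1: "reach n \<phi> u k q (word_val n \<phi> u k q)" by (rule reach_word_val) (use uv kq in auto)
    have 2: "reach n \<phi> (v @ r) q k (word_val n \<phi> v q k + diag_weight \<phi> r k)"
      by (rule reach_append[OF reach_word_val reach_diag]) (use uv kq in auto)
    obtain p where p: "\<And>t. t \<le> length (u @ v @ r) \<Longrightarrow> p t < n" "p 0 = k" "p (length u) = q"
      "p (length (u @ v @ r)) = k"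
      "word_val n \<phi> u k q + (word_val n \<phi> v q k + diag_weight \<phi> r k) \<le> walk_weight \<phi> (u @ v @ r) p"
      using reach_glue[OF 1 2] by metis
    have wr': "w @ r = u @ v @ r" by (simp add: uv)
    have "p (length u) = k"
      by (rule optimal_closed_walk_const[OF wr dom two'])
        (use p ge eq[OF kq(1)] in \<open>auto simp: wr'[symmetric]\<close>, auto simp: uv)
    then show False using p(3) kq by simp
  qed
qed

section \<open>Words with equal diagonals\<close>

text \<open>Concatenate the finitely many words of length at most \<open>K\<close>.\<close>

lemma universal_word:
  assumes "finite (UNIV :: 'l set)"
  obtains z :: "'l list" where "\<And>w. length w \<le> K \<Longrightarrow> \<exists>z1 z2. z = z1 @ w @ z2"
proof -
  have "finite {w :: 'l list. set w \<subseteq> UNIV \<and> length w \<le> K}"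
    by (rule finite_lists_length_le[OF assms])
  from finite_list[OF this]
  obtain ws :: "'l list list" where ws: "set ws = {w. set w \<subseteq> UNIV \<and> length w \<le> K}" ..
  have "\<exists>z1 z2. concat ws = z1 @ w @ z2" if "length w \<le> K" for w
  proof -
    have "w \<in> set ws" using ws that by simp
    then obtain us vs where "ws = us @ w # vs" by (meson split_list)
    then have "concat ws = concat us @ w @ concat vs" by simp
    then show ?thesis by blast
  qed
  then show ?thesis using that by blast
qed

text \<open>A stretch that leaves a node and comes back could be replaced by waiting there, which
  \<open>strict\<close> makes heavier. The bound \<open>R\<close> keeps the lengths of the words in
  \<open>strict\<close> bounded.\<close>

lemma optimal_walk_no_return:
  assumes strict: "\<And>u v k q. u \<noteq> [] \<Longrightarrow> v \<noteq> [] \<Longrightarrow> length (u @ v) \<le> R \<Longrightarrow> k < n \<Longrightarrow> q < n \<Longrightarrow> k \<noteq> q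
      \<Longrightarrow> word_val n \<phi> u k q + word_val n \<phi> v q k < diag_weight \<phi> (u @ v) k"
    and w: "w \<noteq> []" "length w \<le> R"
    and p: "\<And>t. t \<le> length w \<Longrightarrow> p t < n"
      "walk_weight \<phi> w p = word_val n \<phi> w (p 0) (p (length w))"
    and st: "s \<le> \<tau>" "\<tau> \<le> t" "t \<le> length w" "p s = p t"
  shows "p \<tau> = p s"
proof (rule ccontr)
  assume ne: "p \<tau> \<noteq> p s"
  define a where "a = take s w"
  define u where "u = take (\<tau> - s) (drop s w)"
  define v where "v = take (t - \<tau>) (drop \<tau> w)"
  define b where "b = drop t w"
  have "take \<tau> w = a @ u" unfolding a_def u_def using st(1) by (metis le_add_diff_inverse take_add)
  moreover have "take t w = take \<tau> w @ v" unfolding v_def using st(2) by (metis le_add_diff_inverse take_add)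
  ultimately have weq: "w = a @ (u @ v) @ b" unfolding b_def by (metis append_assoc append_take_drop_id)
  have len: "length a = s" "length u = \<tau> - s" "length v = t - \<tau>" "length b = length w - t"
    using st by (auto simp: a_def u_def v_def b_def)
  have "s \<noteq> \<tau>" "\<tau> \<noteq> t" using ne st(4) by auto
  then have uv: "u \<noteq> []" "v \<noteq> []" using len st by auto
  have wt: "walk_weight \<phi> w p = walk_weight \<phi> a p + (walk_weight \<phi> u (\<lambda>x. p (s + x))
      + walk_weight \<phi> v (\<lambda>x. p (\<tau> + x))) + walk_weight \<phi> b (\<lambda>x. p (t + x))"
    unfolding weq walk_weight_append using len st by (simp add: algebra_simps)
  have 1: "walk_weight \<phi> u (\<lambda>x. p (s + x)) \<le> word_val n \<phi> u (p s) (p \<tau>)"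
    using walk_weight_le_word_val[OF uv(1), of "\<lambda>x. p (s + x)" n \<phi>] p(1) len st by simp
  have 2: "walk_weight \<phi> v (\<lambda>x. p (\<tau> + x)) \<le> word_val n \<phi> v (p \<tau>) (p s)"
    using walk_weight_le_word_val[OF uv(2), of "\<lambda>x. p (\<tau> + x)" n \<phi>] p(1) len st by simp
  have 3: "word_val n \<phi> u (p s) (p \<tau>) + word_val n \<phi> v (p \<tau>) (p s) < diag_weight \<phi> (u @ v) (p s)"
    by (rule strict[OF uv]) (use p(1) ne st w(2) weq in auto)
  have "reach n \<phi> a (p 0) (p s) (walk_weight \<phi> a p)"
    by (rule reachI[of _ p]) (use p(1) len st in auto)
  moreover have "reach n \<phi> (u @ v) (p s) (p s) (diag_weight \<phi> (u @ v) (p s))"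
    by (rule reach_diag) (use p(1) st in auto)
  moreover have "reach n \<phi> b (p s) (p (length w)) (walk_weight \<phi> b (\<lambda>x. p (t + x)))"
    by (rule reachI[of _ "\<lambda>x. p (t + x)"]) (use p(1) len st in auto)
  ultimately have "reach n \<phi> w (p 0) (p (length w)) (walk_weight \<phi> a p +
      (diag_weight \<phi> (u @ v) (p s) + walk_weight \<phi> b (\<lambda>x. p (t + x))))"
    using weq reach_append by metis
  from reach_le_word_val[OF this w(1)] show False using p(2) wt 1 2 3 by simp
qed

text \<open>A node that has been left is never visited again, so different moves start at different
  nodes.\<close>

lemma no_return_moves_le:
  assumes p: "\<And>t. t \<le> m \<Longrightarrow> p t < (n::nat)"
    and noret: "\<And>s \<tau> t. s \<le> \<tau> \<Longrightarrow> \<tau> \<le> t \<Longrightarrow> t \<le> m \<Longrightarrow> p s = p t \<Longrightarrow> p \<tau> = p s"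
    and M: "M \<subseteq> {..<m}" "\<And>t. t \<in> M \<Longrightarrow> p t \<noteq> p (Suc t)"
  shows "card M \<le> n"
proof -
  have no: "p s \<noteq> p t" if "s \<in> M" "t \<in> M" "s < t" for s t
    using noret[of s "Suc s" t] M that by fastforce
  have "inj_on p M"
    by (rule inj_onI) (use no in \<open>metis linorder_neqE_nat\<close>)
  moreover have "p ` M \<subseteq> {..<n}" using p M(1) by fastforce
  ultimately show ?thesis using card_inj_on_le[of p M "{..<n}"] by simp
qed

text \<open>Otherwise each of the \<open>n + 1\<close> consecutive blocks of length \<open>b\<close>
  contains a move, but at most \<open>n\<close> moves are possible.\<close>

lemma calm_block:
  assumes p: "\<And>t. t \<le> m \<Longrightarrow> p t < (n::nat)"
    and noret: "\<And>s \<tau> t. s \<le> \<tau> \<Longrightarrow> \<tau> \<le> t \<Longrightarrow> t \<le> m \<Longrightarrow> p s = p t \<Longrightarrow> p \<tau> = p s"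
    and m: "a + Suc n * b \<le> m"
  obtains c where "c \<le> n" "\<And>t. t \<le> b \<Longrightarrow> p (a + c * b + t) = p (a + c * b)"
proof (rule ccontr)
  note witness = that
  assume no: "\<not> thesis"
  have "\<exists>t. a + c * b \<le> t \<and> t < a + Suc c * b \<and> p t \<noteq> p (Suc t)" if "c \<le> n" for c
  proof (rule ccontr)
    assume c: "\<not> ?thesis"
    have "p (a + c * b + t) = p (a + c * b)" if "t \<le> b" for t
      using that
    proof (induction t)
      case (Suc t)
      then show ?case using c by (auto simp: not_less dest!: spec[of _ "a + c * b + t"])
    qed simp
    then show False using witness[OF that] no by blast
  qed
  then obtain f where f: "\<And>c. c \<le> n \<Longrightarrow> a + c * b \<le> f c" "\<And>c. c \<le> n \<Longrightarrow> f c < a + Suc c * b"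
    "\<And>c. c \<le> n \<Longrightarrow> p (f c) \<noteq> p (Suc (f c))" by metis
  have less: "f c < f d" if "c < d" "d \<le> n" for c d
  proof -
    have "f c < a + Suc c * b" using f(2)[of c] that by simp
    also have "\<dots> \<le> a + d * b" using that by (intro add_left_mono mult_le_mono1) simp
    also have "\<dots> \<le> f d" using f(1)[OF that(2)] .
    finally show ?thesis .
  qed
  have "inj_on f {..n}"
    by (rule inj_onI) (use less in \<open>metis atMost_iff less_irrefl linorder_neqE_nat\<close>)
  then have "card (f ` {..n}) = Suc n" by (simp add: card_image)
  moreover have "card (f ` {..n}) \<le> n"
  proof (rule no_return_moves_le[where p = p and m = m, OF p noret])
    show "f ` {..n} \<subseteq> {..<m}"
    proof safe
      fix c assume c: "c \<le> n"
      have "f c < a + Suc c * b" using f(2)[OF c] .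
      also have "\<dots> \<le> a + Suc n * b" using c by (intro add_left_mono mult_le_mono1) simp
      finally show "f c < m" using m by simp
    qed
  qed (use f(3) in auto)
  ultimately show False by simp
qed

text \<open>Keep only the letters on which the walk moves. Each dropped letter contributed
  \<open>\<delta>\<close> of the current node, which is at most \<open>d\<close>, so subtracting
  \<open>d\<close> per dropped letter gives a valid lower bound.\<close>

lemma compress_walk:
  assumes "\<And>t. t \<le> length w \<Longrightarrow> p t < n" "\<And>t. t \<le> length w \<Longrightarrow> \<delta> (p t) \<le> d"
    and "\<And>l k. k < n \<Longrightarrow> \<phi> l k k = \<delta> k"
  shows "\<exists>ls. length ls = card {t. t < length w \<and> p t \<noteq> p (Suc t)} \<and>
    reach n \<phi> ls (p 0) (p (length w)) (walk_weight \<phi> w p - (real (length w) - real (length ls)) * d)"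
  using assms(1,2)
proof (induction w arbitrary: p)
  case (Cons l w)
  define q where "q = (\<lambda>t. p (Suc t))"
  obtain ls where ls: "length ls = card {t. t < length w \<and> q t \<noteq> q (Suc t)}"
    "reach n \<phi> ls (q 0) (q (length w)) (walk_weight \<phi> w q - (real (length w) - real (length ls)) * d)"
    using Cons.IH[of q] Cons.prems by (auto simp: q_def)
  have moves: "{t. t < length (l # w) \<and> p t \<noteq> p (Suc t)}
      = (if p 0 = p 1 then {} else {0}) \<union> Suc ` {t. t < length w \<and> q t \<noteq> q (Suc t)}" (is "?A = ?B")
  proof (rule Set.set_eqI)
    fix t show "t \<in> ?A \<longleftrightarrow> t \<in> ?B" by (cases t) (auto simp: q_def image_iff)
  qed
  have p01: "p 0 < n" "p 1 < n" using Cons.prems(1)[of 0] Cons.prems(1)[of 1] by auto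
  show ?case
  proof (cases "p 0 = p 1")
    case True
    have "length ls = card {t. t < length (l # w) \<and> p t \<noteq> p (Suc t)}"
      unfolding moves using True ls(1) by (simp add: card_image)
    moreover have "reach n \<phi> ls (p 0) (p (length (l # w)))
        (walk_weight \<phi> (l # w) p - (real (length (l # w)) - real (length ls)) * d)"
    proof -
      have "\<phi> l (p 0) (p 1) \<le> d" using True assms(3) p01 Cons.prems(2)[of 0] by simp
      then show ?thesis using ls(2) True by (auto simp: q_def algebra_simps intro: reach_mono)
    qed
    ultimately show ?thesis by blast
  next
    case False
    have "length (l # ls) = card {t. t < length (l # w) \<and> p t \<noteq> p (Suc t)}"
      unfolding moves using False ls(1) by (simp add: card_image card_insert_if image_iff)
    moreover have "reach n \<phi> ([l] @ ls) (p 0) (q (length w))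
        (\<phi> l (p 0) (p 1) + (walk_weight \<phi> w q - (real (length w) - real (length ls)) * d))"
      by (rule reach_append[OF reach_single[OF p01]]) (use ls(2) in \<open>simp add: q_def\<close>)
    then have "reach n \<phi> (l # ls) (p 0) (p (length (l # w)))
        (walk_weight \<phi> (l # w) p - (real (length (l # w)) - real (length (l # ls))) * d)"
      by (simp add: q_def algebra_simps)
    ultimately show ?thesis by blast
  qed
qed simp

lemma diag_weight_uniform:
  fixes d :: real
  shows "(\<And>l. \<phi> l k k = d) \<Longrightarrow> diag_weight \<phi> w k = length w * d"
  by (induction w) (auto simp: algebra_simps)

text \<open>Between a move-free copy of \<open>z\<close> on the left and one on the right, an optimal walk may as well spend
  all its waiting time at the visited node of maximal \<open>\<delta>\<close>, making the moves inside these two copies. The new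
  walk waits while the middle letter is read, and all letters have the same diagonal.\<close>

lemma swap_middle_le:
  fixes \<phi> :: "'l \<Rightarrow> rmat"
  assumes diag: "\<And>l k. k < n \<Longrightarrow> \<phi> l k k = \<delta> k"
    and strict: "\<And>u v k q. u \<noteq> [] \<Longrightarrow> v \<noteq> [] \<Longrightarrow> length (u @ v) \<le> R \<Longrightarrow> k < n \<Longrightarrow> q < n \<Longrightarrow> k \<noteq> q
      \<Longrightarrow> word_val n \<phi> u k q + word_val n \<phi> v q k < diag_weight \<phi> (u @ v) k"
    and z: "\<And>w. length w \<le> n \<Longrightarrow> \<exists>z1 z2. z = z1 @ w @ z2"
    and Z: "Z = concat (replicate (Suc n) z)"
    and R: "length (Z @ [a] @ Z) \<le> R"
    and ij: "i < n" "j < n"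
  shows "word_val n \<phi> (Z @ [a] @ Z) i j \<le> word_val n \<phi> (Z @ [b] @ Z) i j"
proof -
  define w where "w = Z @ [a] @ Z"
  have w0: "w \<noteq> []" by (simp add: w_def)
  obtain p where p: "\<And>t. t \<le> length w \<Longrightarrow> p t < n" "p 0 = i" "p (length w) = j"
    "walk_weight \<phi> w p = word_val n \<phi> w i j"
    using optimal_walk[OF w0 ij] by metis
  have noret: "p \<tau> = p s" if "s \<le> \<tau>" "\<tau> \<le> t" "t \<le> length w" "p s = p t" for s \<tau> t
    by (rule optimal_walk_no_return[OF strict w0 R[folded w_def] p(1) _ that]) (use p in auto)
  have lenZ: "length Z = Suc n * length z"
    unfolding Z by (simp add: length_concat sum_list_replicate)
  \<comment> \<open>\<open>c1\<close> and \<open>c2\<close> count the copies of \<open>z\<close>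
    that precede the move-free copy in the left and in the right factor \<open>Z\<close>.\<close>
  obtain c1 where c1: "c1 \<le> n" "\<And>t. t \<le> length z \<Longrightarrow> p (0 + c1 * length z + t) = p (0 + c1 * length z)"
    by (rule calm_block[where p = p and m = "length w" and a = 0 and b = "length z", OF p(1) noret]) (use lenZ in \<open>auto simp: w_def\<close>)
  obtain c2 where c2: "c2 \<le> n" "\<And>t. t \<le> length z \<Longrightarrow> p (length Z + 1 + c2 * length z + t)
      = p (length Z + 1 + c2 * length z)"
    by (rule calm_block[where p = p and m = "length w" and a = "length Z + 1" and b = "length z", OF p(1) noret]) (use lenZ in \<open>auto simp: w_def\<close>)
  have Zsplit: "Z = concat (replicate c z) @ z @ concat (replicate (n - c) z)" if "c \<le> n" for c
  proof -
    have "replicate (Suc n) z = replicate c z @ [z] @ replicate (n - c) z"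
      using that by (metis Suc_diff_le append_Cons append_Nil le_add_diff_inverse replicate_Suc
          replicate_add le_SucI)
    then show ?thesis unfolding Z by simp
  qed
  define A where "A = concat (replicate c1 z)"
  define B where "B = concat (replicate (n - c2) z)"
  define mid where "mid = (\<lambda>l. concat (replicate (n - c1) z) @ [l] @ concat (replicate c2 z))"
  have ZZ: "Z @ [l] @ Z = A @ z @ mid l @ z @ B" for l
    using Zsplit[OF c1(1)] Zsplit[OF c2(1)] by (simp add: A_def B_def mid_def)
  have weq: "w = A @ z @ mid a @ z @ B" unfolding w_def ZZ ..
  define t0 where "t0 = length A"
  define t1 where "t1 = t0 + length z"
  define t2 where "t2 = t1 + length (mid a)"
  define t3 where "t3 = t2 + length z"
  have lw: "length w = t3 + length B" by (simp add: weq t0_def t1_def t2_def t3_def)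
  have t0': "t0 = c1 * length z" by (simp add: t0_def A_def length_concat sum_list_replicate)
  have t2': "t2 = length Z + 1 + c2 * length z"
  proof -
    have "(n - c1) * length z + c1 * length z = n * length z"
      using c1(1) by (simp add: add_mult_distrib[symmetric])
    then show ?thesis
      unfolding t2_def t1_def t0' lenZ mid_def by (simp add: length_concat sum_list_replicate)
  qed
  define k where "k = p t0"
  define k' where "k' = p t2"
  have calm1: "p (t0 + t) = k" if "t \<le> length z" for t
    using c1(2)[OF that] by (simp add: k_def t0')
  have calm2: "p (t2 + t) = k'" if "t \<le> length z" for t
    using c2(2)[OF that] by (simp add: k'_def t2')
  have kn: "k < n" "k' < n" using p(1) lw by (auto simp: k_def k'_def t1_def t2_def t3_def)
  have "Max ((\<lambda>t. \<delta> (p t)) ` {t1..t2}) \<in> (\<lambda>t. \<delta> (p t)) ` {t1..t2}"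
    by (rule Max_in) (auto simp: t2_def)
  then obtain \<sigma> where \<sigma>: "t1 \<le> \<sigma>" "\<sigma> \<le> t2" "\<delta> (p \<sigma>) = Max ((\<lambda>t. \<delta> (p t)) ` {t1..t2})"
    by auto
  define d where "d = \<delta> (p \<sigma>)"
  have d: "\<delta> (p t) \<le> d" if "t1 \<le> t" "t \<le> t2" for t
    unfolding d_def \<sigma>(3) by (rule Max_ge) (use that in auto)
  have sn: "p \<sigma> < n" using p(1) \<sigma> lw by (simp add: t3_def)
  have dk: "\<delta> k \<le> d" "\<delta> k' \<le> d"
    using d[of t1] d[of t2] calm1[of "length z"] by (auto simp: k'_def t1_def t2_def)
  define m1 where "m1 = take (\<sigma> - t1) (mid a)"
  define m2 where "m2 = drop (\<sigma> - t1) (mid a)"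
  have mm: "mid a = m1 @ m2" by (simp add: m1_def m2_def)
  have lm: "length m1 = \<sigma> - t1" "length m2 = t2 - \<sigma>"
    using \<sigma> by (auto simp: m1_def m2_def t2_def)
  have wt: "walk_weight \<phi> w p = walk_weight \<phi> A p + walk_weight \<phi> z (\<lambda>t. p (t0 + t))
      + walk_weight \<phi> m1 (\<lambda>t. p (t1 + t)) + walk_weight \<phi> m2 (\<lambda>t. p (\<sigma> + t))
      + walk_weight \<phi> z (\<lambda>t. p (t2 + t)) + walk_weight \<phi> B (\<lambda>t. p (t3 + t))"
  proof -
    have "t1 + (\<sigma> - t1 + x) = \<sigma> + x" "\<sigma> + (t2 - \<sigma> + x) = t2 + x" for x using \<sigma> by auto
    then show ?thesis unfolding weq mm append_assoc walk_weight_append lm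
      by (simp add: t0_def t1_def t3_def add.assoc add.left_commute[of "length z" t2])
  qed
  have z1: "walk_weight \<phi> z (\<lambda>t. p (t0 + t)) = length z * \<delta> k"
  proof -
    have "walk_weight \<phi> z (\<lambda>t. p (t0 + t)) = walk_weight \<phi> z (\<lambda>_. k)"
      by (rule walk_weight_cong) (rule calm1)
    then show ?thesis using diag_weight_uniform[of \<phi> k] diag[OF kn(1)] by (simp add: walk_weight_const)
  qed
  have z2: "walk_weight \<phi> z (\<lambda>t. p (t2 + t)) = length z * \<delta> k'"
  proof -
    have "walk_weight \<phi> z (\<lambda>t. p (t2 + t)) = walk_weight \<phi> z (\<lambda>_. k')"
      by (rule walk_weight_cong) (rule calm2)
    then show ?thesis using diag_weight_uniform[of \<phi> k'] diag[OF kn(2)] by (simp add: walk_weight_const)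
  qed
  have compress: "\<exists>ls. length ls \<le> n \<and> reach n \<phi> ls (p s) (p t)
      (walk_weight \<phi> m (\<lambda>x. p (s + x)) - (real (length m) - real (length ls)) * d)"
    if m: "length m = t - s" "t1 \<le> s" "s \<le> t" "t \<le> t2" for m s t
  proof -
    have sub: "x \<le> length w" if "x \<le> t2" for x using that lw by (simp add: t3_def)
    obtain ls where ls: "length ls = card {x. x < length m \<and> p (s + x) \<noteq> p (s + Suc x)}"
      "reach n \<phi> ls (p (s + 0)) (p (s + length m))
      (walk_weight \<phi> m (\<lambda>x. p (s + x)) - (real (length m) - real (length ls)) * d)"
      using compress_walk[of m "\<lambda>x. p (s + x)" n \<delta> d \<phi>] p(1) d diag m sub by auto
    have "card {x. x < length m \<and> p (s + x) \<noteq> p (s + Suc x)} \<le> n"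
    proof (rule no_return_moves_le[of "length m" "\<lambda>x. p (s + x)"])
      show "p (s + x) < n" if "x \<le> length m" for x using p(1) sub m that by simp
      show "p (s + \<tau>) = p (s + x)" if "x \<le> \<tau>" "\<tau> \<le> y" "y \<le> length m" "p (s + x) = p (s + y)" for x \<tau> y
        using noret[of "s + x" "s + \<tau>" "s + y"] sub[of "s + y"] m that by simp
    qed auto
    then show ?thesis using ls m by (intro exI[of _ ls]) simp
  qed
  obtain l1 where l1: "length l1 \<le> n" "reach n \<phi> l1 k (p \<sigma>)
      (walk_weight \<phi> m1 (\<lambda>x. p (t1 + x)) - (real (length m1) - real (length l1)) * d)"
    using compress[of m1 \<sigma> t1] lm \<sigma> calm1[of "length z"] by (auto simp: t1_def)
  obtain l2 where l2: "length l2 \<le> n" "reach n \<phi> l2 (p \<sigma>) k'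
      (walk_weight \<phi> m2 (\<lambda>x. p (\<sigma> + x)) - (real (length m2) - real (length l2)) * d)"
    using compress[of m2 t2 \<sigma>] lm \<sigma> by (auto simp: k'_def)
  \<comment> \<open>\<open>z\<close> contains every word of length at most \<open>n\<close>, so the
    moves before \<open>\<sigma>\<close> fit on the factor \<open>l1\<close> of the left calm copy
    and those after \<open>\<sigma>\<close> on the factor \<open>l2\<close> of the right
    one.\<close>
  obtain x1 x2 where x: "z = x1 @ l1 @ x2" using z[OF l1(1)] by blast
  obtain y1 y2 where y: "z = y1 @ l2 @ y2" using z[OF l2(1)] by blast
  have loop: "reach n \<phi> v q q (length v * \<delta> q)" if "q < n" for v q
    using reach_diag[OF that, of \<phi> v] diag_weight_uniform[of \<phi> q] diag[OF that] by simp
  have rA: "reach n \<phi> A i k (walk_weight \<phi> A p)"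
    by (rule reachI[of _ p]) (use p lw in \<open>auto simp: k_def t0_def t1_def t2_def t3_def\<close>)
  have rB: "reach n \<phi> B k' j (walk_weight \<phi> B (\<lambda>t. p (t3 + t)))"
    by (rule reachI[of _ "\<lambda>t. p (t3 + t)"])
      (use p lw calm2[of "length z"] in \<open>auto simp: t3_def\<close>)
  \<comment> \<open>Route of the new walk: wait at \<open>k\<close> on \<open>x1\<close>, move on
    \<open>l1\<close>, wait at \<open>p \<sigma>\<close> from \<open>x2\<close> through
    \<open>mid b\<close> to \<open>y1\<close>, move on \<open>l2\<close>, wait at \<open>k'\<close>
    on \<open>y2\<close>.\<close>
  have "reach n \<phi> (A @ x1 @ l1 @ x2 @ mid b @ y1 @ l2 @ y2 @ B) i j
    (walk_weight \<phi> A p + (length x1 * \<delta> k +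
      ((walk_weight \<phi> m1 (\<lambda>x. p (t1 + x)) - (real (length m1) - real (length l1)) * d) +
      (length x2 * d + (length (mid b) * d + (length y1 * d +
      ((walk_weight \<phi> m2 (\<lambda>x. p (\<sigma> + x)) - (real (length m2) - real (length l2)) * d) +
      (length y2 * \<delta> k' + walk_weight \<phi> B (\<lambda>t. p (t3 + t))))))))))"
    unfolding d_def
    by (intro reach_append[OF rA] reach_append[OF loop[OF kn(1)]] reach_append[OF l1(2)[unfolded d_def]]
        reach_append[OF loop[OF sn]] reach_append[OF l2(2)[unfolded d_def]]
        reach_append[OF loop[OF kn(2)]] rB)
  moreover have "A @ x1 @ l1 @ x2 @ mid b @ y1 @ l2 @ y2 @ B = Z @ [b] @ Z"
  proof -
    have "A @ (x1 @ l1 @ x2) @ mid b @ (y1 @ l2 @ y2) @ B = Z @ [b] @ Z"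
      unfolding ZZ x[symmetric] y[symmetric] ..
    then show ?thesis by simp
  qed
  ultimately have new: "walk_weight \<phi> A p + (length x1 * \<delta> k +
      ((walk_weight \<phi> m1 (\<lambda>x. p (t1 + x)) - (real (length m1) - real (length l1)) * d) +
      (length x2 * d + (length (mid b) * d + (length y1 * d +
      ((walk_weight \<phi> m2 (\<lambda>x. p (\<sigma> + x)) - (real (length m2) - real (length l2)) * d) +
      (length y2 * \<delta> k' + walk_weight \<phi> B (\<lambda>t. p (t3 + t)))))))))
      \<le> word_val n \<phi> (Z @ [b] @ Z) i j"
    using reach_le_word_val by fastforce
  have "length (mid b) = length (mid a)" by (simp add: mid_def)
  then have "real (length (mid b)) = length m1 + length m2" by (simp add: mm)
  moreover have "length z * \<delta> k = (length x1 + length l1 + length x2) * \<delta> k" by (simp add: x)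
  moreover have "length z * \<delta> k' = (length y1 + length l2 + length y2) * \<delta> k'" by (simp add: y)
  \<comment> \<open>The old walk read \<open>l1\<close> and \<open>x2\<close> at \<open>k\<close>,
    and \<open>y1\<close> and \<open>l2\<close> at \<open>k'\<close>, where each letter earns at
    most \<open>d\<close>.\<close>
  moreover have "(length l1 + length x2) * \<delta> k \<le> (length l1 + length x2) * d"
    by (rule mult_left_mono) (use dk in auto)
  moreover have "(length y1 + length l2) * \<delta> k' \<le> (length y1 + length l2) * d"
    by (rule mult_left_mono) (use dk in auto)
  ultimately show ?thesis
    using new wt p(4) unfolding w_def[symmetric] z1 z2 by (simp add: algebra_simps)
qed

section \<open>Full-rank powers and two words that agree on them\<close>

lemma word_val_subst_const:
  assumes "n > 0" "w \<noteq> []" "m > 0"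
  shows "word_val n \<phi> (subst_word (\<lambda>_. w) (replicate m ())) = word_val n (\<lambda>_. word_val n \<phi> w) (replicate m ())"
  by (rule word_val_subst) (use assms in auto)

lemma length_subst_word_const: "length (subst_word (\<lambda>_. w) (replicate m ())) = length w * m"
  by (induction m) auto

lemma reach_pow_power:
  assumes "n > 0" "D > 0" "reach_pow n (word_val n (\<lambda>_. Z) (replicate D ())) e i j c"
  shows "reach_pow n Z (e * D) i j c"
\<comment> \<open>The value of the empty word is junk, so exponent 0 is treated through the empty
  walk.\<close>
proof (cases "e = 0")
  case False
  have "subst_word (\<lambda>_. replicate D ()) (replicate e ()) = replicate (e * D) ()"
    using length_subst_word_const[of "replicate D ()" e] by (metis length_replicate mult.commute replicate_length_same unit_eq)
  then have "word_val n (\<lambda>_. word_val n (\<lambda>_. Z) (replicate D ())) (replicate e ())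
      = word_val n (\<lambda>_. Z) (replicate (e * D) ())"
    using word_val_subst_const[of n "replicate D ()" e "\<lambda>_. Z"] assms False by simp
  moreover have "c \<le> word_val n (\<lambda>_. word_val n (\<lambda>_. Z) (replicate D ())) (replicate e ()) i j"
    by (rule reach_le_word_val[OF assms(3)]) (use False in simp)
  ultimately show ?thesis
    using reach_word_val[of "replicate (e * D) ()" i n j "\<lambda>_. Z"] reach_lt[OF assms(3)] False assms(2)
    by (auto intro: reach_mono)
qed (use assms in simp)

text \<open>The length \<open>T\<close> of \<open>closed_walk_strict\<close> for
  \<open>D = N = fact n\<close>: every cycle length up to \<open>n\<close> divides
  \<open>fact n\<close>, and \<open>fact n\<close> windows on each side leave room for up to
  \<open>fact n\<close> steps of the \<open>fact n\<close>-th power.\<close>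

definition rank_exponent :: "nat \<Rightarrow> nat" where
  "rank_exponent n = fact n * (n * (n * fact n)) + fact n + fact n * (n * (n * fact n))"

lemma rank_exponent_pos: "rank_exponent n > 0"
  by (simp add: rank_exponent_def)

text \<open>Both claims come from \<open>closed_walk_strict\<close>: with \<open>1\<close> and
  \<open>fact n - 1\<close> steps for the closed walks traced by permutations, and with
  \<open>1\<close> and \<open>1\<close> for the two-step returns.\<close>

lemma full_rank_power:
  assumes n: "n \<ge> 2"
    and full: "\<not> low_rank n (word_val n (\<lambda>_. Z) (replicate (rank_exponent n) ()))"
    and X: "X = word_val n (\<lambda>_. Z) (replicate (fact n) ())"
  shows "perm_dominant n X"
    and "\<And>k q. k < n \<Longrightarrow> q < n \<Longrightarrow> k \<noteq> q \<Longrightarrow> X k q + X q k < 2 * X k k"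
proof -
  have n0: "n > 0" using n by simp
  have D: "\<And>l. l \<in> {1..n} \<Longrightarrow> l dvd fact n" "(fact n :: nat) > 0" by (auto intro: dvd_fact)
  have D1: "1 \<le> (fact n :: nat)" using D(2) by linarith
  have strict: "c1 + c2 < (e1 + e2) * X k k"
    if "k < n" "q \<noteq> k" "e1 \<le> fact n" "e2 \<le> fact n" "reach_pow n X e1 k q c1" "reach_pow n X e2 q k c2"
    for k q e1 e2 c1 c2
  proof -
    have powers: "reach_pow n Z (e1 * fact n) k q c1" "reach_pow n Z (e2 * fact n) q k c2"
      using that(5,6) reach_pow_power[OF n0 D(2)] unfolding X by blast+
    show ?thesis
      unfolding X
      by (rule closed_walk_strict[OF n _ D(2) D(2) rank_exponent_def full that(1-4) powers]) (rule D(1))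
  qed
  show "perm_dominant n X"
  proof (rule perm_dominant_if_closed_walks[where D = "fact n"])
    fix k q c d assume "k < n" "q \<noteq> k" "reach_pow n X 1 k q c" "reach_pow n X (fact n - 1) q k d"
    then have "c + d < real (1 + (fact n - 1)) * X k k" using strict[of k q 1 "fact n - 1" c d] D1 by simp
    then show "c + d < real (fact n) * X k k" using D1 by simp
  qed (use D in auto)
  show "X k q + X q k < 2 * X k k" if kq: "k < n" "q < n" "k \<noteq> q" for k q
  proof -
    have one: "reach_pow n X 1 i j (X i j)" if "i < n" "j < n" for i j
      using reach_single[OF that, of "\<lambda>_. X" "()"] by simp
    show ?thesis using strict[OF _ _ D1 D1 one one, of k q] kq by simp
  qed
qed

lemma diag_weight_subst:
  "diag_weight \<phi> (subst_word \<sigma> w) k = (\<Sum>l\<leftarrow>w. diag_weight \<phi> (\<sigma> l) k)"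
  by (induction w) auto

lemma letter_UNIV: "UNIV = {Letter_a, Letter_b}"
  using letter.exhaust by auto

lemma full_rank_identity:
  assumes n: "n \<ge> 2"
  obtains K and r s :: "letter list" where "r \<noteq> s" "r \<noteq> []" "length r = length s"
    "\<And>\<phi> i j. (\<And>w. w \<noteq> [] \<Longrightarrow> length w \<le> K \<Longrightarrow> \<not> low_rank n (word_val n \<phi> w)) \<Longrightarrow>
      i < n \<Longrightarrow> j < n \<Longrightarrow> word_val n \<phi> r i j = word_val n \<phi> s i j"
proof -
  let ?D = "fact n :: nat" and ?T = "rank_exponent n"
  have n0: "n > 0" using n by simp
  have D0: "?D > 0" by simp
  \<comment> \<open>\<open>\<sigma>1\<close> passes to \<open>fact n\<close>-th powers
    \<open>x\<close> and \<open>y\<close>, whose diagonals are dominant; \<open>\<sigma>2\<close>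
    then forms \<open>x y\<close> and \<open>y x\<close>, whose diagonals agree.\<close>
  define \<sigma>1 :: "letter \<Rightarrow> letter list" where "\<sigma>1 = replicate ?D"
  define \<sigma>2 where "\<sigma>2 = case_letter [Letter_a, Letter_b] [Letter_b, Letter_a]"
  have \<sigma>1: "\<sigma>1 l \<noteq> []" "length (\<sigma>1 l) = ?D" for l by (auto simp: \<sigma>1_def)
  have "\<sigma>2 l \<noteq> [] \<and> length (\<sigma>2 l) = 2" for l by (cases l) (simp_all add: \<sigma>2_def)
  then have \<sigma>2: "\<sigma>2 l \<noteq> []" "length (\<sigma>2 l) = 2" for l by simp_all
  have inj1: "inj \<sigma>1" by (rule injI) (simp add: \<sigma>1_def)
  have inj2: "inj \<sigma>2" by (rule injI) (auto simp: \<sigma>2_def split: letter.splits)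
  have "finite (UNIV :: letter set)" by (simp add: letter_UNIV)
  then obtain z :: "letter list" where z: "\<And>w. length w \<le> n \<Longrightarrow> \<exists>z1 z2. z = z1 @ w @ z2"
    using universal_word by metis
  define Z where "Z = concat (replicate (Suc n) z)"
  define R where "R = length (Z @ [Letter_a] @ Z)"
  define word where "word = (\<lambda>l. subst_word \<sigma>1 (subst_word \<sigma>2 (Z @ [l] @ Z)))"
  \<comment> \<open>\<open>K\<close> allows every word of length at most
    \<open>fact n * (2 * R)\<close> to be raised to the power
    \<open>rank_exponent n\<close>.\<close>
  define K where "K = ?D * (2 * R) * ?T"
  have len: "length (word l) = ?D * (2 * R)" for l
    unfolding word_def length_subst_word[OF \<sigma>1(2)] length_subst_word[OF \<sigma>2(2)] by (simp add: R_def)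
  have R0: "R > 0" by (simp add: R_def)
  show ?thesis
  proof (rule that[of "word Letter_a" "word Letter_b" K])
    show "word Letter_a \<noteq> word Letter_b"
    proof
      assume "word Letter_a = word Letter_b"
      then have "subst_word \<sigma>2 (Z @ [Letter_a] @ Z) = subst_word \<sigma>2 (Z @ [Letter_b] @ Z)"
        unfolding word_def
        by (rule subst_word_inj[OF \<sigma>1(2) inj1, rotated]) (simp only: length_subst_word[OF \<sigma>2(2)], simp)
      then have "Z @ [Letter_a] @ Z = Z @ [Letter_b] @ Z"
        by (rule subst_word_inj[OF \<sigma>2(2) inj2, rotated]) simp
      then show False by simp
    qed
    show "word Letter_a \<noteq> []" using len[of Letter_a] R0 by force
    show "length (word Letter_a) = length (word Letter_b)" by (simp add: len)
  next
    fix \<phi> :: "letter \<Rightarrow> rmat" and i j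
    assume full: "\<And>w. w \<noteq> [] \<Longrightarrow> length w \<le> K \<Longrightarrow> \<not> low_rank n (word_val n \<phi> w)"
      and ij: "i < n" "j < n"
    have full_power: "\<not> low_rank n (word_val n (\<lambda>_. word_val n \<phi> w) (replicate ?T ()))"
      if "w \<noteq> []" "length w \<le> ?D * (2 * R)" for w
    proof -
      have "\<not> low_rank n (word_val n \<phi> (subst_word (\<lambda>_. w) (replicate ?T ())))"
      proof (rule full)
        show "subst_word (\<lambda>_. w) (replicate ?T ()) \<noteq> []"
          using rank_exponent_pos[of n] that(1) by (simp add: subst_word_eq_Nil_iff)
        show "length (subst_word (\<lambda>_. w) (replicate ?T ())) \<le> K"
          unfolding length_subst_word_const K_def using that(2) by (rule mult_le_mono1)
      qed
      then show ?thesis by (simp add: word_val_subst_const[OF n0 that(1) rank_exponent_pos])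
    qed
    define \<chi> where "\<chi> = (\<lambda>l. word_val n \<phi> (\<sigma>1 l))"
    have dom: "perm_dominant n (\<chi> l)" for l
    proof (rule full_rank_power(1)[OF n full_power])
      have "subst_word (\<lambda>_. [l]) (replicate m ()) = replicate m l" for m by (induction m) auto
      then have "subst_word (\<lambda>_. [l]) (replicate ?D ()) = \<sigma>1 l" by (simp add: \<sigma>1_def)
      then show "\<chi> l = word_val n (\<lambda>_. word_val n \<phi> [l]) (replicate ?D ())"
        using word_val_subst_const[OF n0 _ D0, of "[l]" \<phi>] by (simp add: \<chi>_def)
      show "length [l] \<le> ?D * (2 * R)" using D0 R0 by (simp add: Suc_le_eq)
    qed simp
    have \<chi>_subst: "word_val n \<phi> (subst_word \<sigma>1 w) = word_val n \<chi> w" if "w \<noteq> []" for w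
      unfolding \<chi>_def by (rule word_val_subst[OF n0 \<sigma>1(1) that])
    \<comment> \<open>A word \<open>w\<close> in \<open>\<chi>\<close> is a word in
      \<open>\<phi>\<close> whose \<open>rank_exponent n\<close>-th power still has full rank, so
      \<open>full_rank_power\<close> applies to its \<open>fact n\<close>-th power.\<close>
    have two: "word_val n \<chi> (subst_word (\<lambda>_. w) (replicate ?D ())) k q + word_val n \<chi> (subst_word (\<lambda>_. w) (replicate ?D ())) q k
      < 2 * word_val n \<chi> (subst_word (\<lambda>_. w) (replicate ?D ())) k k"
      if w: "w \<noteq> []" "length w \<le> 2 * R" and kq: "k < n" "q < n" "k \<noteq> q" for w k q
    proof (rule full_rank_power(2)[OF n full_power _ kq])
      show "subst_word \<sigma>1 w \<noteq> []" using w(1) \<sigma>1(1) by (simp add: subst_word_eq_Nil_iff)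
      show "length (subst_word \<sigma>1 w) \<le> ?D * (2 * R)" using w(2) by (simp add: length_subst_word[OF \<sigma>1(2)])
      show "word_val n \<chi> (subst_word (\<lambda>_. w) (replicate ?D ()))
          = word_val n (\<lambda>_. word_val n \<phi> (subst_word \<sigma>1 w)) (replicate ?D ())"
        by (simp add: \<chi>_subst w(1) word_val_subst_const[OF n0 w(1) D0])
    qed
    note closed = closed_words_diag[OF _ D0 dom two]
    define \<psi> where "\<psi> = (\<lambda>l. word_val n \<chi> (\<sigma>2 l))"
    define \<delta> where "\<delta> = (\<lambda>k. \<chi> Letter_a k k + \<chi> Letter_b k k)"
    have \<psi>_subst: "word_val n \<chi> (subst_word \<sigma>2 w) = word_val n \<psi> w" if "w \<noteq> []" for w
      unfolding \<psi>_def by (rule word_val_subst[OF n0 \<sigma>2(1) that])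
    have \<psi>_diag: "\<psi> l k k = diag_weight \<chi> (\<sigma>2 l) k" if "k < n" for l k
      unfolding \<psi>_def
      by (rule closed(1)[OF \<sigma>2(1) \<sigma>2(1) _ _ _ _ that]) (use \<sigma>2(2) R0 in \<open>auto simp: Suc_le_eq\<close>)
    have \<delta>: "\<psi> l k k = \<delta> k" if "k < n" for l k
      unfolding \<psi>_diag[OF that] by (cases l) (auto simp: \<delta>_def \<sigma>2_def)
    have strict: "word_val n \<psi> u k q + word_val n \<psi> v q k < diag_weight \<psi> (u @ v) k"
      if uv: "u \<noteq> []" "v \<noteq> []" "length (u @ v) \<le> R" and kq: "k < n" "q < n" "k \<noteq> q" for u v k q
    proof -
      have ne: "subst_word \<sigma>2 w \<noteq> []" if "w \<noteq> []" for w
        using that \<sigma>2(1) by (simp add: subst_word_eq_Nil_iff)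
      have "word_val n \<chi> (subst_word \<sigma>2 u) k q + word_val n \<chi> (subst_word \<sigma>2 v) q k
          < diag_weight \<chi> (subst_word \<sigma>2 (u @ v)) k"
      proof (rule closed(2)[OF _ _ _ _ _ _ _ ne[OF uv(1)] ne[OF uv(2)] kq])
        show "length (subst_word \<sigma>2 (u @ v)) \<le> 2 * R"
          unfolding length_subst_word[OF \<sigma>2(2)] using uv(3) by simp
      qed (use ne uv in auto)
      moreover have "diag_weight \<chi> (subst_word \<sigma>2 (u @ v)) k = diag_weight \<psi> (u @ v) k"
        unfolding diag_weight_subst diag_weight_def[of \<psi>] \<psi>_diag[OF kq(1)] ..
      ultimately show ?thesis by (simp add: \<psi>_subst uv)
    qed
    have swap: "word_val n \<psi> (Z @ [a] @ Z) i j \<le> word_val n \<psi> (Z @ [b] @ Z) i j" for a b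
    proof (rule swap_middle_le[where R = R and z = z, OF \<delta> _ _ Z_def])
      show "length (Z @ [a] @ Z) \<le> R" by (simp add: R_def)
    qed (use strict z ij in auto)
    have val: "word_val n \<phi> (word l) = word_val n \<psi> (Z @ [l] @ Z)" for l
    proof -
      have ne: "subst_word \<sigma>2 (Z @ [l] @ Z) \<noteq> []" using \<sigma>2(1)[of l] by simp
      show ?thesis unfolding word_def \<chi>_subst[OF ne] by (rule \<psi>_subst) simp
    qed
    show "word_val n \<phi> (word Letter_a) i j = word_val n \<phi> (word Letter_b) i j"
      unfolding val by (intro antisym swap)
  qed
qed

section \<open>Identities for real matrices\<close>

definition real_identity :: "nat \<Rightarrow> 'l list \<Rightarrow> 'l list \<Rightarrow> bool" where
  "real_identity n u v \<longleftrightarrow> (\<forall>\<phi>. \<forall>i<n. \<forall>j<n. word_val n \<phi> u i j = word_val n \<phi> v i j)"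

text \<open>If \<open>C = P Q\<close> with inner dimension \<open>m\<close>, then \<open>C (G\<^sub>1 C) \<cdots> (G\<^sub>r C) = P (Q G\<^sub>1 P) \<cdots> (Q G\<^sub>r P) Q\<close>
  turns a word in \<open>n \<times> n\<close> matrices into the same word in \<open>m \<times> m\<close> matrices.\<close>

lemma word_val_factor:
  assumes "m > 0" "n > 0" "w \<noteq> []"
  shows "maxplus_mult n (maxplus_mult m P Q) (word_val n (\<lambda>l. maxplus_mult n (G l) (maxplus_mult m P Q)) w)
    = maxplus_mult m P (maxplus_mult m (word_val m (\<lambda>l. maxplus_mult n Q (maxplus_mult n (G l) P)) w) Q)"
  using assms(3)
proof (induction w)
  case (Cons l w)
  show ?case
  proof (cases "w = []")
    case False
    then show ?thesis using Cons.IH by (simp add: word_val_Cons maxplus_mult_assoc assms(1,2))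
  qed (simp add: maxplus_mult_assoc assms(1,2))
qed simp

lemma low_rank_word:
  assumes "n \<ge> 2" "low_rank n (word_val n \<phi> w)" "w \<noteq> []"
  shows "low_rank n (word_val n \<phi> (u @ w @ v))"
proof -
  have "low_rank n (word_val n \<phi> (w @ v))"
    by (cases "v = []")
      (use assms in \<open>simp_all add: word_val_append low_rank_mult_right\<close>)
  then show ?thesis
    by (cases "u = []") (use assms in \<open>simp_all add: word_val_append low_rank_mult_left\<close>)
qed

lemma real_identity_step:
  fixes p q :: "letter list"
  assumes n: "n \<ge> 2" and pq: "p \<noteq> q" "p \<noteq> []" "length p = length q" "real_identity (n - 1) p q"
  shows "\<exists>u v :: letter list. u \<noteq> v \<and> u \<noteq> [] \<and> length u = length v \<and> real_identity n u v"
proof -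
  have n0: "n > 0" "n - 1 > 0" using n by auto
  have q0: "q \<noteq> []" using pq(2,3) by auto
  obtain K and r s :: "letter list" where rs: "r \<noteq> s" "r \<noteq> []" "length r = length s"
    "\<And>\<phi> i j. (\<And>w. w \<noteq> [] \<Longrightarrow> length w \<le> K \<Longrightarrow> \<not> low_rank n (word_val n \<phi> w)) \<Longrightarrow>
      i < n \<Longrightarrow> j < n \<Longrightarrow> word_val n \<phi> r i j = word_val n \<phi> s i j"
    using full_rank_identity[OF n] by metis
  have s0: "s \<noteq> []" using rs(2,3) by auto
  have "finite (UNIV :: letter set)" by (simp add: letter_UNIV)
  \<comment> \<open>\<open>Suc K\<close> instead of \<open>K\<close> forces \<open>c\<close> to
    contain a letter even if \<open>K = 0\<close>.\<close>
  then obtain c :: "letter list" where c: "\<And>w. length w \<le> Suc K \<Longrightarrow> \<exists>z1 z2. c = z1 @ w @ z2"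
    using universal_word by metis
  have c0: "c \<noteq> []" using c[of "[Letter_a]"] by auto
  define \<rho> where "\<rho> = case_letter r s"
  define \<sigma> where "\<sigma> = (\<lambda>l. \<rho> l @ c)"
  have \<rho>0: "\<rho> l \<noteq> []" for l by (cases l) (auto simp: \<rho>_def rs s0)
  have \<sigma>0: "\<sigma> l \<noteq> []" for l by (simp add: \<sigma>_def c0)
  have \<sigma>len: "length (\<sigma> l) = length r + length c" for l
    by (cases l) (auto simp: \<rho>_def \<sigma>_def rs(3))
  have \<sigma>inj: "inj \<sigma>"
    by (rule injI) (use rs(1) in \<open>auto simp: \<rho>_def \<sigma>_def split: letter.splits\<close>)
  have ne: "subst_word \<sigma> w \<noteq> []" if "w \<noteq> []" for w
    using that \<sigma>0 by (simp add: subst_word_eq_Nil_iff)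
  have val: "word_val n \<phi> (c @ subst_word \<sigma> w)
      = maxplus_mult n (word_val n \<phi> c) (word_val n (\<lambda>l. maxplus_mult n (word_val n \<phi> (\<rho> l)) (word_val n \<phi> c)) w)"
    if "w \<noteq> []" for w \<phi>
    unfolding word_val_append[OF n0(1) c0 ne[OF that]] word_val_subst[OF n0(1) \<sigma>0 that]
    by (simp add: \<sigma>_def word_val_append[OF n0(1) \<rho>0 c0])
  have "word_val n \<phi> (c @ subst_word \<sigma> p) i j = word_val n \<phi> (c @ subst_word \<sigma> q) i j"
    if ij: "i < n" "j < n" for \<phi> i j
  proof (cases "\<exists>w. w \<noteq> [] \<and> length w \<le> K \<and> low_rank n (word_val n \<phi> w)")
    case True
    then obtain w where w: "w \<noteq> []" "length w \<le> K" "low_rank n (word_val n \<phi> w)" by blast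
    then obtain z1 z2 where "c = z1 @ w @ z2" using c[of w] by auto
    then have "low_rank n (word_val n \<phi> c)" using low_rank_word[OF n w(3,1)] by simp
    then obtain P Q where PQ: "\<And>i j. i < n \<Longrightarrow> j < n \<Longrightarrow> word_val n \<phi> c i j = maxplus_mult (n - 1) P Q i j"
      unfolding low_rank_def by blast
    have eq: "word_val n \<phi> (c @ subst_word \<sigma> w) i j = maxplus_mult (n - 1) P (maxplus_mult (n - 1)
        (word_val (n - 1) (\<lambda>l. maxplus_mult n Q (maxplus_mult n (word_val n \<phi> (\<rho> l)) P)) w) Q) i j"
      if w0: "w \<noteq> []" for w
      unfolding val[OF w0] word_val_factor[OF n0(2,1) w0, symmetric]
      by (intro maxplus_mult_cong word_val_cong) (use PQ ij in auto)
    show ?thesis unfolding eq[OF pq(2)] eq[OF q0]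
      by (intro maxplus_mult_cong) (use pq(4) in \<open>auto simp: real_identity_def\<close>)
  next
    case False
    \<comment> \<open>Here \<open>r\<close> and \<open>s\<close> have equal values, so both sides
      are words in a single matrix and depend only on the common length of \<open>p\<close> and
      \<open>q\<close>.\<close>
    have \<rho>eq: "word_val n \<phi> (\<rho> l) i j = word_val n \<phi> r i j" if "i < n" "j < n" for l i j
    proof -
      have "word_val n \<phi> r i j = word_val n \<phi> s i j"
        by (rule rs(4)[OF _ that]) (use False in blast)
      then show ?thesis by (cases l) (auto simp: \<rho>_def)
    qed
    have eq: "word_val n \<phi> (c @ subst_word \<sigma> w) i j = maxplus_mult n (word_val n \<phi> c)
        (word_val n (\<lambda>_. maxplus_mult n (word_val n \<phi> r) (word_val n \<phi> c)) (replicate (length w) ())) i j"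
      if w0: "w \<noteq> []" for w
      unfolding val[OF w0] word_val_const[symmetric]
      by (intro maxplus_mult_cong word_val_cong) (use \<rho>eq ij in auto)
    show ?thesis unfolding eq[OF pq(2)] eq[OF q0] pq(3) ..
  qed
  moreover have "c @ subst_word \<sigma> p \<noteq> c @ subst_word \<sigma> q"
    using subst_word_inj[OF \<sigma>len \<sigma>inj pq(3)] pq(1) by auto
  moreover have "length (c @ subst_word \<sigma> p) = length (c @ subst_word \<sigma> q)"
    by (simp add: length_subst_word[OF \<sigma>len] pq(3))
  ultimately show ?thesis
    using c0 unfolding real_identity_def by (metis append_is_Nil_conv)
qed

text \<open>Equal lengths are part of the induction: \<open>real_identity_step\<close> needs them to
  keep the substituted words distinct and to treat the case where both letters have the same
  value.\<close>

lemma real_identity_exists: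
  assumes "n \<ge> 1"
  shows "\<exists>u v :: letter list. u \<noteq> v \<and> u \<noteq> [] \<and> length u = length v \<and> real_identity n u v"
  using assms
proof (induction n rule: dec_induct)
  case base
  \<comment> \<open>One-by-one max-plus matrices multiply by adding real numbers, hence
    commute.\<close>
  have "{..<Suc 0} = {0}" by auto
  then have "real_identity 1 [Letter_a, Letter_b] [Letter_b, Letter_a]"
    by (simp add: real_identity_def maxplus_mult_def)
  then show ?case by (intro exI[of _ "[Letter_a, Letter_b]"] exI[of _ "[Letter_b, Letter_a]"]) simp
next
  case (step n)
  then obtain p q :: "letter list" where "p \<noteq> q" "p \<noteq> []" "length p = length q" "real_identity n p q"
    by blast
  then show ?case using real_identity_step[of "Suc n" p q] step.hyps by simp
qed

section \<open>From real to tropical matrices\<close>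

text \<open>A tropical matrix is approximated by the real matrices in which \<open>-\<infinity>\<close> is replaced by \<open>-K\<close>, \<open>K \<rightarrow> \<infinity>\<close>.\<close>

fun approximates :: "(nat \<Rightarrow> real) \<Rightarrow> tropical \<Rightarrow> bool" where
  "approximates f (Num_arc_delta r) \<longleftrightarrow> eventually (\<lambda>K. f K = r) sequentially"
| "approximates f MinInfty_delta \<longleftrightarrow> filterlim f at_bot sequentially"

lemma approximates_add:
  assumes "approximates f x" "approximates g y"
  shows "approximates (\<lambda>K. max (f K) (g K)) (x + y)"
proof (cases x; cases y)
  fix r s assume "x = Num_arc_delta r" "y = Num_arc_delta s"
  then show ?thesis using assms by (auto elim: eventually_elim2)
next
  fix r assume xy: "x = Num_arc_delta r" "y = MinInfty_delta"
  then have "eventually (\<lambda>K. g K \<le> r) sequentially" using assms by (simp add: filterlim_at_bot)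
  moreover have "eventually (\<lambda>K. f K = r) sequentially" using xy assms by simp
  ultimately show ?thesis using xy by (auto elim: eventually_elim2)
next
  fix r assume xy: "x = MinInfty_delta" "y = Num_arc_delta r"
  then have "eventually (\<lambda>K. f K \<le> r) sequentially" using assms by (simp add: filterlim_at_bot)
  moreover have "eventually (\<lambda>K. g K = r) sequentially" using xy assms by simp
  ultimately show ?thesis using xy by (auto elim: eventually_elim2)
next
  assume "x = MinInfty_delta" "y = MinInfty_delta"
  then show ?thesis using assms by (simp add: filterlim_at_bot eventually_conj_iff)
qed

text \<open>Every approximating sequence is eventually bounded above, so adding it to one that tends
  to minus infinity again tends to minus infinity.\<close>

lemma approximates_mult:
  assumes "approximates f x" "approximates g y"
  shows "approximates (\<lambda>K. f K + g K) (x * y)"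
proof -
  have bot: "filterlim (\<lambda>K. a K + b K) at_bot sequentially"
    if "eventually (\<lambda>K. a K \<le> r) sequentially" "filterlim b at_bot sequentially" for a b :: "nat \<Rightarrow> real" and r
    unfolding filterlim_at_bot
  proof
    fix Z
    have "eventually (\<lambda>K. b K \<le> Z - r) sequentially" using that(2) by (simp add: filterlim_at_bot)
    with that(1) show "eventually (\<lambda>K. a K + b K \<le> Z) sequentially" by eventually_elim simp
  qed
  have bounded: "\<exists>r. eventually (\<lambda>K. h K \<le> r) sequentially" if "approximates h v" for h v
    using that by (cases v) (auto simp: filterlim_at_bot elim: eventually_mono)
  show ?thesis
  proof (cases x; cases y)
    fix r s assume "x = Num_arc_delta r" "y = Num_arc_delta s"
    then show ?thesis using assms by (auto elim: eventually_elim2)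
  next
    fix r assume "x = Num_arc_delta r" "y = MinInfty_delta"
    then show ?thesis using assms bot[of f _ g] bounded[OF assms(1)] by auto
  next
    fix r assume "x = MinInfty_delta" "y = Num_arc_delta r"
    then show ?thesis using assms bot[of g _ f] bounded[OF assms(2)] by (auto simp: add.commute)
  next
    assume "x = MinInfty_delta" "y = MinInfty_delta"
    then show ?thesis using assms bot[of f _ g] bounded[OF assms(1)] by auto
  qed
qed

text \<open>This transfers equalities from real to tropical entries. An eventually constant sequence
  cannot tend to minus infinity.\<close>

lemma approximates_unique:
  assumes "approximates f x" "approximates f y" shows "x = y"
proof -
  have no: False if "eventually (\<lambda>K. f K = r) sequentially" "filterlim f at_bot sequentially" for r
  proof -
    have "eventually (\<lambda>K. f K \<le> r - 1) sequentially" using that(2) by (simp add: filterlim_at_bot)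
    with that(1) have "eventually (\<lambda>K. False) sequentially" by eventually_elim simp
    then show False by simp
  qed
  have eq: "r = s" if "eventually (\<lambda>K. f K = r) sequentially" "eventually (\<lambda>K. f K = s) sequentially" for r s
  proof -
    from that have "eventually (\<lambda>K :: nat. r = s) sequentially" by eventually_elim simp
    then show ?thesis by simp
  qed
  show ?thesis using assms no eq by (cases x; cases y) auto
qed

lemma approximates_sum:
  fixes n :: nat
  assumes "n > 0" "\<And>k. k < n \<Longrightarrow> approximates (\<lambda>K. f K k) (x k)"
  shows "approximates (\<lambda>K. Max (f K ` {..<n})) (\<Sum>k<n. x k)"
  using assms
proof (induction n rule: nat_induct_non_zero)
  case 1
  then show ?case by (simp add: lessThan_Suc)
next
  case (Suc n)
  have "Max (f K ` {..<Suc n}) = max (Max (f K ` {..<n})) (f K n)" for K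
    using Suc.hyps by (simp add: lessThan_Suc max.commute lessThan_empty_iff)
  then show ?case using Suc by (simp add: approximates_add)
qed

lemma approximates_word_val:
  assumes n: "n > 0" and \<Phi>: "\<Phi> \<in> semigroup_homs words (@) (tropical_mats n) (*)"
    and letters: "\<And>l i j. i < n \<Longrightarrow> j < n \<Longrightarrow> approximates (\<lambda>K. \<phi> K l i j) (\<Phi> [l] $$ (i, j))"
    and w: "w \<noteq> []" and ij: "i < n" "j < n"
  shows "approximates (\<lambda>K. word_val n (\<phi> K) w i j) (\<Phi> w $$ (i, j))"
  using w ij(1)
proof (induction w arbitrary: i)
  case (Cons l w)
  show ?case
  proof (cases "w = []")
    case False
    have carrier: "\<Phi> [l] \<in> tropical_mats n" "\<Phi> w \<in> tropical_mats n"
      using \<Phi> False by (auto simp: semigroup_homs_def words_def)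
    have "\<Phi> ([l] @ w) = \<Phi> [l] * \<Phi> w"
      using \<Phi> False unfolding semigroup_homs_def words_def by blast
    then have prod: "\<Phi> (l # w) = \<Phi> [l] * \<Phi> w" by simp
    have "\<Phi> (l # w) $$ (i, j) = (\<Sum>k<n. \<Phi> [l] $$ (i, k) * \<Phi> w $$ (k, j))"
      unfolding prod using carrier Cons.prems(2) ij(2)
      by (simp add: scalar_prod_def atLeast0LessThan)
    moreover have "approximates (\<lambda>K. Max ((\<lambda>k. \<phi> K l i k + word_val n (\<phi> K) w k j) ` {..<n}))
        (\<Sum>k<n. \<Phi> [l] $$ (i, k) * \<Phi> w $$ (k, j))"
      by (intro approximates_sum[OF n] approximates_mult letters Cons.IH False Cons.prems(2))
    ultimately show ?thesis using False by (simp add: word_val_Cons maxplus_mult_def)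
  qed (use Cons letters ij(2) in auto)
qed simp

theorem corollary3p9:
  fixes n :: nat and S :: "'s set" and f :: "'s \<Rightarrow> 's \<Rightarrow> 's"
  assumes "n \<ge> 1"
    and "semigroup_on S f"
    and "\<exists>\<rho>\<in>semigroup_homs S f (tropical_mats n) (*). inj_on \<rho> S"
  shows "\<exists>u\<in>words. \<exists>v\<in>words. u \<noteq> v \<and> satisfies_identity S f u v"
proof -
  obtain u v :: "letter list" where uv: "u \<noteq> v" "u \<noteq> []" "length u = length v" "real_identity n u v"
    using real_identity_exists[OF assms(1)] by blast
  have v0: "v \<noteq> []" using uv(2,3) by auto
  obtain \<rho> where \<rho>: "\<rho> \<in> semigroup_homs S f (tropical_mats n) (*)" "inj_on \<rho> S"
    using assms(3) by blast
  have "\<phi> u = \<phi> v" if \<phi>: "\<phi> \<in> semigroup_homs words (@) S f" for \<phi>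
  proof -
    \<comment> \<open>Composing with \<open>\<rho>\<close> reduces the claim to matrices;
      injectivity of \<open>\<rho>\<close> on \<open>S\<close> brings it back at the end.\<close>
    define \<Phi> where "\<Phi> = \<rho> \<circ> \<phi>"
    have \<Phi>: "\<Phi> \<in> semigroup_homs words (@) (tropical_mats n) (*)"
      using \<rho>(1) \<phi> by (auto simp: semigroup_homs_def \<Phi>_def Pi_iff)
    define \<psi> where "\<psi> = (\<lambda>(K :: nat) l i j. case \<Phi> [l] $$ (i, j) of
      Num_arc_delta r \<Rightarrow> r | MinInfty_delta \<Rightarrow> - real K)"
    have bot: "filterlim (\<lambda>K. - real K) at_bot sequentially"
      using filterlim_real_sequentially by (simp add: filterlim_uminus_at_top)
    have "approximates (\<lambda>K. \<psi> K l i j) (\<Phi> [l] $$ (i, j))" for l i j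
      unfolding \<psi>_def by (cases "\<Phi> [l] $$ (i, j)") (auto simp: bot)
    then have appr: "approximates (\<lambda>K. word_val n (\<psi> K) w i j) (\<Phi> w $$ (i, j))"
      if "w \<noteq> []" "i < n" "j < n" for w i j
      using approximates_word_val[OF _ \<Phi> _ that] assms(1) by simp
    have mats: "\<Phi> u \<in> tropical_mats n" "\<Phi> v \<in> tropical_mats n"
      using \<Phi> uv(2) v0 by (auto simp: semigroup_homs_def words_def)
    have "\<Phi> u = \<Phi> v"
    proof (rule eq_matI)
      fix i j assume "i < dim_row (\<Phi> v)" "j < dim_col (\<Phi> v)"
      then have ij: "i < n" "j < n" using mats by auto
      \<comment> \<open>The real identity holds for each \<open>K\<close>, so one and the same
        sequence approximates both tropical entries.\<close>
      have "word_val n (\<psi> K) u i j = word_val n (\<psi> K) v i j" for K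
        using uv(4) ij by (simp add: real_identity_def)
      then show "\<Phi> u $$ (i, j) = \<Phi> v $$ (i, j)"
        using approximates_unique appr[OF uv(2) ij] appr[OF v0 ij] by simp
    qed (use mats in auto)
    moreover have "\<phi> u \<in> S" "\<phi> v \<in> S"
      using \<phi> uv(2) v0 by (auto simp: semigroup_homs_def words_def)
    ultimately show ?thesis using \<rho>(2) by (simp add: \<Phi>_def inj_on_eq_iff)
  qed
  then show ?thesis using uv(1,2) v0 by (auto simp: satisfies_identity_def words_def)
qed

end
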